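(* Let $P$ be any finite poset and let $\lambda=(\lambda_1,\dots,\lambda_r)$ be a partition of $|P|$. Then the number $\eta^\lambda(\mathrm{inc}(P))$ is equal to each of the following: (1) the number of $P$-descent-free $P$-tableaux of shape $\lambda$; (2) the number of $P$-excedance-free $P$-tableaux of shape $\lambda$; (3) the number of acyclic orientations of sequences $(\mathrm{inc}(P_{I_1}),\dots,\mathrm{inc}(P_{I_r}))$ in $\mathcal I_\lambda(\mathrm{inc}(P))$, i.e., the total number of sequences $(O_1,\dots,O_r)$ such that, for some ordered set partition $(I_1,\dots,I_r)$ of the elements of $P$ of type $\lambda$, $O_j$ is an acyclic orientation of $\mathrm{inc}(P_{I_j})$ for each $j$.
   Context: Let $n=|P|$; the elements of $P$ carry distinct integer labels $1,\dots,n$ (any fixed labeling). Trace evaluations at graphs: for a graph $G$ on $n$ vertices and $\lambda=(\lambda_1,\dots,\lambda_\ell)\vdash n$, let $c(G,\lambda)$ be the number of proper colorings of $G$ by positive integers in which exactly $\lambda_i$ vertices have color $i$ for $i=1,\dots,\ell$. Let $\epsilon^\lambda$ be the character of $\mathfrak S_n$ induced from the sign character of the Young subgroup $\mathfrak S_\lambda$; the $\epsilon^\lambda$ form a basis of the space of class functions. For a class function $\theta=\sum_{\lambda\vdash n}a_\lambda\epsilon^\lambda$ define $\theta(G)=\sum_{\lambda\vdash n}a_\lambda c(G,\lambda)$. Let $\eta^\lambda$ be the character of $\mathfrak S_n$ induced from the trivial character of $\mathfrak S_\lambda$. (Equivalently, $\eta^\lambda(G)$ is the coefficient of the monomial symmetric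 function $m_\lambda$ in $\omega X_G$, where $X_G=\sum_\lambda c(G,\lambda)m_\lambda$ is Stanley's chromatic symmetric function and $\omega$ is the standard involution with $\omega(e_k)=h_k$.) The incomparability graph $\mathrm{inc}(P)$ has vertex set $P$ and an edge $\{i,j\}$ for each incomparable pair. $P_I$ denotes the subposet of $P$ induced by a subset $I$. A $P$-tableau of shape $\lambda$ is a filling of a Young diagram of shape $\lambda$ (with $\lambda_i$ boxes in row $i$) with the elements of $P$, each used exactly once, one per box; $U_{i,j}$ is the $j$th entry of row $i$. It is $P$-descent-free if there is no position $(i,j)$ with $U_{i,j}>_P U_{i,j+1}$. Let $\overline U$ be obtained from $U$ by sorting each row so that labels increase (as integers) from left to right. $U$ is $P$-excedance-free if there is no position $(i,j)$ with $U_{i,j}>_P\overline U_{i,j}$. An ordered set partition of a set of $n$ elements of type $\lambda$ is a sequence $(I_1,\dots,I_r)$ of pairwise disjoint subsets with union the whole set and $|I_i|=\lambda_i$. For a graph $G$, $\mathcal I_\lambda(G)$ is the set of sequences $(G_{I_1},\dots,G_{I_r})$ of induced subgraphs over all ordered set partitions of the vertex set of type $\lambda$. An acyclic orientation of a graph is a choice of direction for each edge producing no directed cycle; an acyclic orientation of $(G_{I_1},\dots,G_{I_r})$ is a sequence $(O_1,\dots,O_r)$ with $O_j$ an acyclic orientation of $G_{I_j}$. *)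

theory Defs
  imports Complex_Main "HOL-Algebra.Sym_Groups"
begin

text \<open>A partition is a weakly decreasing list of positive integers; its entries, like the
  positions in rows, columns and sequences below, are indexed from 0.\<close>

definition partitions_of :: "nat \<Rightarrow> nat list set" where
  "partitions_of n = {lam. sorted_wrt (\<ge>) lam \<and> 0 \<notin> set lam \<and> sum_list lam = n}"


section \<open>Induced characters of symmetric groups\<close>

definition induced_character ::
    "('g, 'm) monoid_scheme \<Rightarrow> 'g set \<Rightarrow> ('g \<Rightarrow> complex) \<Rightarrow> 'g \<Rightarrow> complex" where
  "induced_character G H \<chi> g =
     (\<Sum>x\<in>carrier G.
        (let y = inv\<^bsub>G\<^esub> x \<otimes>\<^bsub>G\<^esub> g \<otimes>\<^bsub>G\<^esub> x in if y \<in> H then \<chi> y else 0))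
     / of_nat (card H)"

text \<open>The Young subgroup preserves each of the consecutive blocks
  \<open>{1..lam\<^sub>1}\<close>, \<open>{lam\<^sub>1+1..lam\<^sub>1+lam\<^sub>2}\<close>, \<dots>\<close>

definition young_block :: "nat list \<Rightarrow> nat \<Rightarrow> nat set" where
  "young_block lam i = {sum_list (take i lam) <.. sum_list (take (Suc i) lam)}"

definition young_subgroup :: "nat list \<Rightarrow> (nat \<Rightarrow> nat) set" where
  "young_subgroup lam =
     {p \<in> carrier (sym_group (sum_list lam)).
        \<forall>i<length lam. p ` young_block lam i = young_block lam i}"

definition eps_character :: "nat list \<Rightarrow> (nat \<Rightarrow> nat) \<Rightarrow> complex" where
  "eps_character lam =
     induced_character (sym_group (sum_list lam)) (young_subgroup lam) (\<lambda>p. of_int (sign p))"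

definition eta_character :: "nat list \<Rightarrow> (nat \<Rightarrow> nat) \<Rightarrow> complex" where
  "eta_character lam =
     induced_character (sym_group (sum_list lam)) (young_subgroup lam) (\<lambda>p. 1)"


section \<open>Graphs, colorings and trace evaluations\<close>

text \<open>A graph is a pair of a vertex set and a set of two-element subsets of it.\<close>

type_synonym 'a graph = "'a set \<times> 'a set set"

abbreviation vertices :: "'a graph \<Rightarrow> 'a set" where "vertices G \<equiv> fst G"
abbreviation edges :: "'a graph \<Rightarrow> 'a set set" where "edges G \<equiv> snd G"

definition induced_subgraph :: "'a graph \<Rightarrow> 'a set \<Rightarrow> 'a graph" where
  "induced_subgraph G I = (I, {e \<in> edges G. e \<subseteq> I})"

text \<open>Colorings are undefined outside the vertex set, so that the set below is
  counted correctly. If \<open>lam\<close> is a partition of the number of vertices, then no color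
  larger than \<open>length lam\<close> can occur.\<close>

definition proper_colorings_of_type :: "'a graph \<Rightarrow> nat list \<Rightarrow> ('a \<Rightarrow> nat) set" where
  "proper_colorings_of_type G lam =
     {c \<in> vertices G \<rightarrow>\<^sub>E {1..}.
        (\<forall>x y. {x, y} \<in> edges G \<longrightarrow> c x \<noteq> c y) \<and>
        (\<forall>i<length lam. card {v \<in> vertices G. c v = Suc i} = lam ! i)}"

text \<open>The coefficients of a class function of the symmetric group with respect to the basis
  formed by the characters \<open>eps_character mu\<close>. They are set to 0 outside
  \<open>partitions_of n\<close> to make them unique as a function on lists.\<close>

definition eps_coeffs :: "nat \<Rightarrow> ((nat \<Rightarrow> nat) \<Rightarrow> complex) \<Rightarrow> nat list \<Rightarrow> complex" where
  "eps_coeffs n \<theta> =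
     (THE a. (\<forall>mu. mu \<notin> partitions_of n \<longrightarrow> a mu = 0) \<and>
             (\<forall>g\<in>carrier (sym_group n).
                \<theta> g = (\<Sum>mu\<in>partitions_of n. a mu * eps_character mu g)))"

definition trace_evaluation :: "((nat \<Rightarrow> nat) \<Rightarrow> complex) \<Rightarrow> 'a graph \<Rightarrow> complex" where
  "trace_evaluation \<theta> G =
     (let n = card (vertices G)
      in \<Sum>mu\<in>partitions_of n.
           eps_coeffs n \<theta> mu * of_nat (card (proper_colorings_of_type G mu)))"


section \<open>Posets\<close>

text \<open>A poset is a carrier \<open>P\<close> with a relation \<open>r\<close> such that \<open>partial_order_on P r\<close>.\<close>

definition poset_greater :: "'a rel \<Rightarrow> 'a \<Rightarrow> 'a \<Rightarrow> bool" where
  "poset_greater r x y \<longleftrightarrow> (y, x) \<in> r \<and> x \<noteq> y"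

definition inc_graph :: "'a set \<Rightarrow> 'a rel \<Rightarrow> 'a graph" where
  "inc_graph P r = (P, {{x, y} |x y. x \<in> P \<and> y \<in> P \<and> (x, y) \<notin> r \<and> (y, x) \<notin> r})"


section \<open>Tableaux\<close>

text \<open>A tableau is the list of its rows.\<close>

definition tableaux :: "'a set \<Rightarrow> nat list \<Rightarrow> 'a list list set" where
  "tableaux P lam = {U. map length U = lam \<and> distinct (concat U) \<and> set (concat U) = P}"

definition descent_free :: "'a rel \<Rightarrow> 'a list list \<Rightarrow> bool" where
  "descent_free r U \<longleftrightarrow>
     \<not> (\<exists>i j. i < length U \<and> Suc j < length (U ! i) \<and>
              poset_greater r (U ! i ! j) (U ! i ! Suc j))"

definition sort_rows :: "('a \<Rightarrow> nat) \<Rightarrow> 'a list list \<Rightarrow> 'a list list" where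
  "sort_rows lab U = map (sort_key lab) U"

definition excedance_free :: "'a rel \<Rightarrow> ('a \<Rightarrow> nat) \<Rightarrow> 'a list list \<Rightarrow> bool" where
  "excedance_free r lab U \<longleftrightarrow>
     \<not> (\<exists>i j. i < length U \<and> j < length (U ! i) \<and>
              poset_greater r (U ! i ! j) (sort_rows lab U ! i ! j))"


section \<open>Acyclic orientations of sequences of induced subgraphs\<close>

definition ordered_set_partitions :: "'a set \<Rightarrow> nat list \<Rightarrow> 'a set list set" where
  "ordered_set_partitions V lam =
     {Is. map card Is = lam \<and> \<Union>(set Is) = V \<and>
          (\<forall>i<length Is. \<forall>j<length Is. i \<noteq> j \<longrightarrow> Is ! i \<inter> Is ! j = {})}"

definition induced_sequences :: "nat list \<Rightarrow> 'a graph \<Rightarrow> 'a graph list set" where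
  "induced_sequences lam G =
     map (induced_subgraph G) ` ordered_set_partitions (vertices G) lam"

text \<open>An orientation is a directed graph, that is, a pair of a vertex set and an arc set. Keeping
  the vertex set is essential for the count: all edgeless graphs have the same arc set.\<close>

definition acyclic_orientation :: "'a graph \<Rightarrow> 'a set \<times> 'a rel \<Rightarrow> bool" where
  "acyclic_orientation G D \<longleftrightarrow>
     fst D = vertices G \<and> bij_betw (\<lambda>(x, y). {x, y}) (snd D) (edges G) \<and> acyclic (snd D)"

definition acyclic_orientation_sequences :: "'a graph list \<Rightarrow> ('a set \<times> 'a rel) list set" where
  "acyclic_orientation_sequences Gs = {Os. list_all2 acyclic_orientation Gs Os}"

text \<open>The induced subgraphs of the incomparability graph are the incomparability graphs of the
  subposets.\<close>

lemma induced_subgraph_inc_graph: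
  assumes "I \<subseteq> P"
  shows "induced_subgraph (inc_graph P r) I = inc_graph I (Restr r I)"
  using assms unfolding induced_subgraph_def inc_graph_def by auto

lemma induced_sequences_inc_graph:
  "induced_sequences lam (inc_graph P r) =
     map (\<lambda>I. inc_graph I (Restr r I)) ` ordered_set_partitions P lam"
  unfolding induced_sequences_def
proof (rule image_cong)
  show "ordered_set_partitions (vertices (inc_graph P r)) lam = ordered_set_partitions P lam"
    by (simp add: inc_graph_def)
next
  fix Is assume "Is \<in> ordered_set_partitions P lam"
  then show "map (induced_subgraph (inc_graph P r)) Is = map (\<lambda>I. inc_graph I (Restr r I)) Is"
    by (auto simp: ordered_set_partitions_def intro!: induced_subgraph_inc_graph)
qed

end

(*
  In terms of the characters eps, eta^lam is the signed sum of eps^beta over all refinements beta of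
  lam by compositions of its parts. Hence eta^lam(inc P) is a signed count of tableaux of shape lam
  whose rows are cut into strictly descending blocks. For a fixed tableau the signs cancel as soon
  as some row contains a descent, because every descent may or may not be a cut; this gives (1).
  The expansion of eta^lam is an instance of the same cancellation: evaluate at a permutation g and
  replace P by the set of orbits of g, weighted by their sizes and totally ordered.

  Rowwise, (2) follows from Foata's correspondence between words and permutations, built by
  inserting maximal elements one at a time, and (3) from reading off a word from an acyclic
  orientation by always removing the least source.
*)

theory Submission
  imports Defs "HOL-Combinatorics.Multiset_Permutations"
begin

section \<open>Cutting words at descents\<close>

text \<open>\<open>trace_evaluation\<close> is defined through the unique coefficients of a class
  function, so an expansion of eta^lam is of use only once the characters
  \<open>eps_character mu\<close> are known to be linearly independent. The two cancellations, at a
  permutation and at the poset, are instances of one signed count for an arbitrary relation. To make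
  this possible rows are measured by a weight, which is 1 for elements of P and the orbit size for
  orbits. Fillings meet characters and colorings because a finite chain of a strict order has
  exactly one monotone listing: monotone fillings, ordered set partitions into chains, and functions
  whose level sets are chains are equinumerous. For a linear order every set is a chain, so
  increasing and decreasing fillings are counted by the same invariant functions. The signs agree
  because a permutation of n points with k orbits has sign (-1)^(n+k), and k is the number of
  letters that are filled in.\<close>

definition cuts :: "('a \<Rightarrow> 'a \<Rightarrow> bool) \<Rightarrow> 'a list \<Rightarrow> 'a list list set" where
  "cuts gt u = {bs. concat bs = u \<and> (\<forall>b\<in>set bs. b \<noteq> [] \<and> successively gt b)}"

lemma cuts_Nil: "cuts gt [] = {[]}"
proof -
  have "bs = []" if "bs \<in> cuts gt []" for bs
    using that by (cases bs) (auto simp: cuts_def)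
  then show ?thesis by (auto simp: cuts_def)
qed

lemma cuts_single: "cuts gt [x] = {[[x]]}"
proof -
  have "bs = [[x]]" if "bs \<in> cuts gt [x]" for bs
  proof (cases bs)
    case Nil
    then show ?thesis using that by (simp add: cuts_def)
  next
    case (Cons b bs')
    with that have b: "b @ concat bs' = [x]" "b \<noteq> []" "\<forall>c\<in>set bs'. c \<noteq> []"
      by (auto simp: cuts_def)
    then have "b = [x]" "concat bs' = []"
      by (auto simp: append_eq_Cons_conv)
    with b have "bs' = []" by (cases bs') auto
    with Cons \<open>b = [x]\<close> show ?thesis by simp
  qed
  then show ?thesis by (auto simp: cuts_def)
qed

text \<open>The first letter either is a block of its own or joins the block of the second letter,
  which requires a descent. Blocks are nonempty, so \<open>hd bs\<close> starts with that second
  letter.\<close>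

lemma cuts_Cons_Cons:
  "cuts gt (x # y # u) =
     (\<lambda>bs. [x] # bs) ` cuts gt (y # u) \<union>
     (if gt x y then (\<lambda>bs. (x # hd bs) # tl bs) ` cuts gt (y # u) else {})"
  (is "?L = ?R")
proof (intro equalityI subsetI)
  fix bs assume bs: "bs \<in> ?L"
  then obtain b bs' where bs_eq: "bs = b # bs'" by (cases bs) (auto simp: cuts_def)
  with bs have b: "b @ concat bs' = x # y # u" "b \<noteq> []" "successively gt b"
      "\<forall>c\<in>set bs'. c \<noteq> [] \<and> successively gt c"
    by (auto simp: cuts_def)
  then obtain b' where b': "b = x # b'" "b' @ concat bs' = y # u"
    by (cases b) auto
  show "bs \<in> ?R"
  proof (cases b')
    case Nil
    with b b' bs_eq show ?thesis by (auto simp: cuts_def)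
  next
    case (Cons z b'')
    with b b' have "gt x y" "b' # bs' \<in> cuts gt (y # u)"
      by (auto simp: cuts_def)
    moreover from this(2) have "bs \<in> (\<lambda>bs. (x # hd bs) # tl bs) ` cuts gt (y # u)"
      by (rule rev_image_eqI) (simp add: bs_eq b')
    ultimately show ?thesis by simp
  qed
next
  fix bs assume "bs \<in> ?R"
  then consider (sep) cs where "cs \<in> cuts gt (y # u)" "bs = [x] # cs"
    | (join) cs where "cs \<in> cuts gt (y # u)" "bs = (x # hd cs) # tl cs" "gt x y"
    by (auto split: if_splits)
  then show "bs \<in> ?L"
  proof cases
    case sep
    then show ?thesis by (auto simp: cuts_def)
  next
    case join
    then obtain c cs' where cs: "cs = c # cs'" by (cases cs) (auto simp: cuts_def)
    with join obtain c' where "c = y # c'" by (cases c) (auto simp: cuts_def)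
    with join cs show ?thesis by (auto simp: cuts_def)
  qed
qed

lemma finite_cuts: "finite (cuts gt u)"
proof (induction u rule: induct_list012)
  case (3 x y zs)
  then show ?case by (simp add: cuts_Cons_Cons)
qed (simp_all add: cuts_Nil cuts_single)

text \<open>A block of length at least two at the front can be separated after its first letter, and this
  cancels everything as soon as the word starts with a descent.\<close>

lemma sum_cuts:
  "(\<Sum>bs\<in>cuts gt u. (-1) ^ length bs :: int) =
     (if successively (\<lambda>x y. \<not> gt x y) u then (-1) ^ length u else 0)"
proof (induction u rule: induct_list012)
  case (3 x y zs)
  let ?C = "cuts gt (y # zs)"
  have ne: "bs \<noteq> [] \<and> hd bs \<noteq> []" if "bs \<in> ?C" for bs
    using that by (cases bs) (auto simp: cuts_def)
  have inj1: "inj_on (\<lambda>bs. [x] # bs) ?C" by (auto intro: inj_onI)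
  have inj2: "inj_on (\<lambda>bs. (x # hd bs) # tl bs) ?C"
  proof (rule inj_onI)
    fix bs cs assume "bs \<in> ?C" "cs \<in> ?C" "(x # hd bs) # tl bs = (x # hd cs) # tl cs"
    with ne[of bs] ne[of cs] show "bs = cs" by (metis list.expand list.inject)
  qed
  have disj: "(\<lambda>bs. [x] # bs) ` ?C \<inter> (\<lambda>bs. (x # hd bs) # tl bs) ` ?C = {}"
    using ne by fastforce
  have s1: "(\<Sum>bs\<in>(\<lambda>bs. [x] # bs) ` ?C. (-1) ^ length bs) = - (\<Sum>bs\<in>?C. (-1) ^ length bs :: int)"
    by (subst sum.reindex[OF inj1]) (simp add: sum_negf)
  have s2: "(\<Sum>bs\<in>(\<lambda>bs. (x # hd bs) # tl bs) ` ?C. (-1) ^ length bs)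
      = (\<Sum>bs\<in>?C. (-1) ^ length bs :: int)"
    by (subst sum.reindex[OF inj2]) (use ne in \<open>auto intro!: sum.cong\<close>)
  show ?case
  proof (cases "gt x y")
    case True
    have "(\<Sum>bs\<in>cuts gt (x # y # zs). (-1) ^ length bs :: int) = 0"
      unfolding cuts_Cons_Cons using True
      by (simp add: sum.union_disjoint[OF _ _ disj] finite_cuts s1 s2)
    with True show ?thesis by simp
  next
    case False
    with 3 s1 show ?thesis by (simp add: cuts_Cons_Cons)
  qed
qed (simp_all add: cuts_Nil cuts_single)

text \<open>One cut for each row. The three list levels of \<open>WW\<close> are the rows, the
  blocks of a row and the letters of a block.\<close>

definition cutss :: "('a \<Rightarrow> 'a \<Rightarrow> bool) \<Rightarrow> 'a list list \<Rightarrow> 'a list list list set" where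
  "cutss gt U = {WW. list_all2 (\<lambda>bs u. bs \<in> cuts gt u) WW U}"

lemma mem_cutss_iff:
  "WW \<in> cutss gt U \<longleftrightarrow>
     map concat WW = U \<and> (\<forall>bs\<in>set WW. \<forall>b\<in>set bs. b \<noteq> [] \<and> successively gt b)"
  unfolding cutss_def
  by (induction WW arbitrary: U) (auto simp: list_all2_Cons1 cuts_def)

lemma sum_cutss:
  "(\<Sum>WW\<in>cutss gt U. (-1) ^ length (concat WW) :: int) =
     (if \<forall>u\<in>set U. successively (\<lambda>x y. \<not> gt x y) u then (-1) ^ length (concat U) else 0)"
proof (induction U)
  case Nil
  then show ?case by (simp add: cutss_def)
next
  case (Cons u U)
  have eq: "cutss gt (u # U) = (\<lambda>(bs, WW). bs # WW) ` (cuts gt u \<times> cutss gt U)"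
    by (auto simp: cutss_def list_all2_Cons2)
  have "(\<Sum>WW\<in>cutss gt (u # U). (-1) ^ length (concat WW) :: int) =
      (\<Sum>(bs, WW)\<in>cuts gt u \<times> cutss gt U. (-1) ^ length bs * (-1) ^ length (concat WW))"
    unfolding eq by (subst sum.reindex) (auto intro!: inj_onI sum.cong simp: power_add)
  also have "\<dots> = (\<Sum>bs\<in>cuts gt u. (-1) ^ length bs) * (\<Sum>WW\<in>cutss gt U. (-1) ^ length (concat WW))"
    by (simp add: sum_product sum.cartesian_product)
  finally show ?case by (simp add: Cons.IH sum_cuts power_add)
qed

section \<open>Fillings with prescribed row weights\<close>

definition wt :: "('a \<Rightarrow> nat) \<Rightarrow> 'a list \<Rightarrow> nat" where
  "wt w u = sum_list (map w u)"

lemma wt_Nil [simp]: "wt w [] = 0"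
  by (simp add: wt_def)

lemma wt_append [simp]: "wt w (u @ v) = wt w u + wt w v"
  by (simp add: wt_def)

lemma wt_concat: "wt w (concat us) = sum_list (map (wt w) us)"
  by (induction us) auto

lemma wt_eq_0_iff: "\<forall>x\<in>set u. w x > 0 \<Longrightarrow> wt w u = 0 \<longleftrightarrow> u = []"
  by (auto simp: wt_def)

lemma wt_distinct: "distinct u \<Longrightarrow> wt w u = sum w (set u)"
  by (simp add: wt_def sum_list_distinct_conv_sum_set)

text \<open>With weight 1 these are the tableaux of shape \<open>\<beta>\<close>. For a permutation
  the letters are its orbits, and a row may have fewer letters than the part it realizes.\<close>

definition fillings :: "'a set \<Rightarrow> ('a \<Rightarrow> nat) \<Rightarrow> nat list \<Rightarrow> 'a list list set" where
  "fillings X w \<beta> = {U. map (wt w) U = \<beta> \<and> distinct (concat U) \<and> set (concat U) = X}"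

definition monotone_fillings ::
    "('a \<Rightarrow> 'a \<Rightarrow> bool) \<Rightarrow> 'a set \<Rightarrow> ('a \<Rightarrow> nat) \<Rightarrow> nat list \<Rightarrow> 'a list list set" where
  "monotone_fillings gt X w \<beta> = {U \<in> fillings X w \<beta>. \<forall>u\<in>set U. successively gt u}"

lemma finite_fillings:
  assumes "finite X"
  shows "finite (fillings X w \<beta>)"
proof (rule finite_subset)
  show "fillings X w \<beta> \<subseteq>
      {U. set U \<subseteq> {u. set u \<subseteq> X \<and> length u \<le> card X} \<and> length U = length \<beta>}"
  proof
    fix U assume U: "U \<in> fillings X w \<beta>"
    then have "u \<in> {u. set u \<subseteq> X \<and> length u \<le> card X}" if "u \<in> set U" for u
    proof -
      have "distinct u" "set u \<subseteq> X"
        using U that by (auto simp: fillings_def distinct_concat_iff)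
      then show ?thesis using card_mono[OF assms \<open>set u \<subseteq> X\<close>] by (simp add: distinct_card)
    qed
    with U show "U \<in> {U. set U \<subseteq> {u. set u \<subseteq> X \<and> length u \<le> card X} \<and> length U = length \<beta>}"
      by (auto simp: fillings_def)
  qed
  show "finite {U. set U \<subseteq> {u. set u \<subseteq> X \<and> length u \<le> card X} \<and> length U = length \<beta>}"
    by (intro finite_lists_length_eq finite_lists_length_le assms)
qed

lemma finite_monotone_fillings: "finite X \<Longrightarrow> finite (monotone_fillings gt X w \<beta>)"
  by (simp add: monotone_fillings_def finite_fillings)

text \<open>An element \<open>as\<close> refines every part of \<open>lam\<close> by a composition,
  and \<open>concat as\<close> is the resulting refinement of \<open>lam\<close>. Excluding zero
  parts makes the set finite and matches the nonempty blocks of a cut.\<close>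

definition composition_lists :: "nat list \<Rightarrow> nat list list set" where
  "composition_lists lam = {as. map sum_list as = lam \<and> (\<forall>\<alpha>\<in>set as. 0 \<notin> set \<alpha>)}"

lemma length_le_sum_list: "0 \<notin> set (\<alpha> :: nat list) \<Longrightarrow> length \<alpha> \<le> sum_list \<alpha>"
  by (induction \<alpha>) auto

lemma finite_composition_lists: "finite (composition_lists lam)"
proof (rule finite_subset)
  let ?n = "sum_list lam"
  show "composition_lists lam \<subseteq>
      {as. set as \<subseteq> {\<alpha>. set \<alpha> \<subseteq> {..?n} \<and> length \<alpha> \<le> ?n} \<and> length as = length lam}"
  proof
    fix as assume as: "as \<in> composition_lists lam"
    have "\<alpha> \<in> {\<alpha>. set \<alpha> \<subseteq> {..?n} \<and> length \<alpha> \<le> ?n}" if "\<alpha> \<in> set as" for \<alpha>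
    proof -
      have "sum_list \<alpha> \<in> set lam" using as that by (auto simp: composition_lists_def)
      then have "sum_list \<alpha> \<le> ?n" by (intro member_le_sum_list) simp_all
      moreover have "length \<alpha> \<le> sum_list \<alpha>"
        using as that by (auto simp: composition_lists_def intro: length_le_sum_list)
      ultimately show ?thesis using member_le_sum_list[of _ \<alpha>] by force
    qed
    with as show "as \<in> {as. set as \<subseteq> {\<alpha>. set \<alpha> \<subseteq> {..?n} \<and> length \<alpha> \<le> ?n} \<and> length as = length lam}"
      by (auto simp: composition_lists_def)
  qed
  show "finite {as. set as \<subseteq> {\<alpha>. set \<alpha> \<subseteq> {..?n} \<and> length \<alpha> \<le> ?n} \<and> length as = length lam}"
    by (intro finite_lists_length_eq finite_lists_length_le) auto
qed

text \<open>A bracketing of the image of a list lifts to the list itself. With the uniqueness in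
  \<open>concat_same_shape\<close>, a bracketed list of blocks is the same as a flat list of blocks
  with a bracketing of their weights.\<close>

lemma ex_unconcat:
  assumes "map f Bs = concat as"
  obtains WW where "map (map f) WW = as" "concat WW = Bs"
  using assms
proof (induction as arbitrary: Bs thesis)
  case Nil
  then show ?case by auto
next
  case (Cons \<alpha> as)
  then obtain Bs1 Bs2 where Bs: "Bs = Bs1 @ Bs2" "map f Bs1 = \<alpha>" "map f Bs2 = concat as"
    by (auto simp: map_eq_append_conv)
  obtain WW where "map (map f) WW = as" "concat WW = Bs2"
    using Cons.IH[OF _ Bs(3)] by blast
  with Bs have "map (map f) (Bs1 # WW) = \<alpha> # as" "concat (Bs1 # WW) = Bs" by auto
  then show ?case by (rule Cons.prems(1))
qed

lemma concat_same_shape: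
  assumes "map (map f) xs = map (map f) ys" "concat xs = concat ys"
  shows "xs = ys"
proof (rule concat_injective[OF assms(2)])
  show len: "length xs = length ys" using assms(1) by (metis length_map)
  show "\<forall>(x, y)\<in>set (zip xs ys). length x = length y"
  proof clarify
    fix x y assume "(x, y) \<in> set (zip xs ys)"
    then obtain i where "i < length xs" "i < length ys" "x = xs ! i" "y = ys ! i"
      by (auto simp: set_zip)
    moreover from this assms(1) have "map f x = map f y" by (metis nth_map)
    ultimately show "length x = length y" using map_eq_imp_length_eq by blast
  qed
qed

lemma concat_map_concat: "concat (map concat xsss) = concat (concat xsss)"
  by (induction xsss) auto

text \<open>Bracketed fillings \<open>WW\<close> are counted in two ways. As a refinement of
  \<open>lam\<close> together with a flat list of monotone blocks they give the left side; as a
  filling \<open>map concat WW\<close> of shape \<open>lam\<close> with a cut of each row they give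
  the right side, by \<open>sum_cutss\<close>.\<close>

lemma signed_count_monotone_fillings:
  fixes w :: "'a \<Rightarrow> nat"
  assumes "finite X" and w: "\<And>x. x \<in> X \<Longrightarrow> w x > 0"
  shows "(\<Sum>as\<in>composition_lists lam.
            (-1) ^ length (concat as) * int (card (monotone_fillings gt X w (concat as)))) =
         (-1) ^ card X * int (card (monotone_fillings (\<lambda>x y. \<not> gt x y) X w lam))"
proof -
  define Z where "Z = {WW. map (map (wt w)) WW \<in> composition_lists lam \<and>
    concat WW \<in> monotone_fillings gt X w (concat (map (map (wt w)) WW))}"
  let ?f = "\<lambda>WW. (map (map (wt w)) WW, concat WW)"
  let ?S = "SIGMA as:composition_lists lam. monotone_fillings gt X w (concat as)"
  have finS: "finite ?S"
    by (intro finite_SigmaI finite_composition_lists finite_monotone_fillings assms)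
  have inj: "inj_on ?f Z"
    by (rule inj_onI) (auto intro: concat_same_shape)
  have img: "?f ` Z = ?S"
  proof (intro equalityI subsetI)
    fix p assume "p \<in> ?S"
    then obtain as Bs where p: "p = (as, Bs)" "as \<in> composition_lists lam"
      "Bs \<in> monotone_fillings gt X w (concat as)" by auto
    then have "map (wt w) Bs = concat as" by (simp add: monotone_fillings_def fillings_def)
    from ex_unconcat[OF this] obtain WW where "map (map (wt w)) WW = as" "concat WW = Bs" by blast
    with p show "p \<in> ?f ` Z" by (auto simp: Z_def image_iff)
  qed (auto simp: Z_def)
  have finZ: "finite Z" using finS inj img by (metis finite_imageD)
  have "(\<Sum>as\<in>composition_lists lam.
          (-1) ^ length (concat as) * int (card (monotone_fillings gt X w (concat as)))) =
        (\<Sum>as\<in>composition_lists lam. \<Sum>Bs\<in>monotone_fillings gt X w (concat as).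
          (-1) ^ length (concat as))"
    by (simp add: mult.commute)
  also have "\<dots> = (\<Sum>(as, Bs)\<in>?S. (-1) ^ length (concat as))"
    by (rule sum.Sigma) (auto intro: finite_composition_lists finite_monotone_fillings assms)
  also have "\<dots> = (\<Sum>WW\<in>Z. (-1) ^ length (concat WW))"
    unfolding img[symmetric]
    by (subst sum.reindex[OF inj])
      (auto intro!: sum.cong simp: length_concat o_def map_concat[symmetric])
  also have "\<dots> = (\<Sum>U\<in>fillings X w lam. \<Sum>WW\<in>{WW \<in> Z. map concat WW = U}. (-1) ^ length (concat WW))"
  proof (rule sum.group[OF finZ finite_fillings[OF assms(1)], symmetric])
    show "map concat ` Z \<subseteq> fillings X w lam"
    proof clarify
      fix WW assume WW: "WW \<in> Z"
      have "map (wt w) (map concat WW) = map sum_list (map (map (wt w)) WW)"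
        by (simp add: wt_concat)
      also have "\<dots> = lam" using WW by (simp add: Z_def composition_lists_def)
      finally show "map concat WW \<in> fillings X w lam"
        using WW by (auto simp: Z_def monotone_fillings_def fillings_def concat_map_concat)
    qed
  qed
  also have "\<dots> = (\<Sum>U\<in>fillings X w lam. \<Sum>WW\<in>cutss gt U. (-1) ^ length (concat WW))"
  proof (intro sum.cong refl)
    fix U assume U: "U \<in> fillings X w lam"
    show "{WW \<in> Z. map concat WW = U} = cutss gt U"
    proof (intro equalityI subsetI)
      fix WW assume "WW \<in> {WW \<in> Z. map concat WW = U}"
      then have WW: "WW \<in> Z" "map concat WW = U" by auto
      have "b \<noteq> [] \<and> successively gt b" if "bs \<in> set WW" "b \<in> set bs" for bs b
        using WW that by (force simp: Z_def composition_lists_def monotone_fillings_def)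
      with WW(2) show "WW \<in> cutss gt U"
        by (simp add: mem_cutss_iff)
    next
      fix WW assume "WW \<in> cutss gt U"
      then have *: "map concat WW = U" "\<And>bs b. bs \<in> set WW \<Longrightarrow> b \<in> set bs \<Longrightarrow> b \<noteq> [] \<and> successively gt b"
        by (auto simp: mem_cutss_iff)
      have cc: "concat (concat WW) = concat U" using *(1) by (auto simp: concat_map_concat)
      have "map sum_list (map (map (wt w)) WW) = map (wt w) (map concat WW)"
        by (simp add: wt_concat)
      then have "map sum_list (map (map (wt w)) WW) = lam"
        using U *(1) by (simp add: fillings_def)
      \<comment> \<open>Positive weights turn nonempty blocks into nonzero parts of a
        composition.\<close>
      moreover have "wt w b \<noteq> 0" if "bs \<in> set WW" "b \<in> set bs" for bs b
      proof -
        have "set b \<subseteq> set (concat (concat WW))" using that by auto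
        also have "\<dots> = X" using U cc by (simp add: fillings_def)
        finally have "\<forall>x\<in>set b. w x > 0" using w by auto
        from wt_eq_0_iff[OF this] *(2)[OF that] show ?thesis by simp
      qed
      ultimately have comp: "map (map (wt w)) WW \<in> composition_lists lam"
        by (force simp: composition_lists_def)
      have fill: "distinct (concat (concat WW))" "set (concat (concat WW)) = X"
        using U unfolding cc fillings_def by blast+
      have "concat WW \<in> monotone_fillings gt X w (concat (map (map (wt w)) WW))"
        using fill * by (auto simp: monotone_fillings_def fillings_def map_concat)
      with comp show "WW \<in> {WW \<in> Z. map concat WW = U}" using *(1) by (simp add: Z_def)
    qed
  qed
  also have "\<dots> = (\<Sum>U\<in>fillings X w lam.
      if \<forall>u\<in>set U. successively (\<lambda>x y. \<not> gt x y) u then (-1) ^ card X else 0)"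
  proof (intro sum.cong refl)
    fix U assume "U \<in> fillings X w lam"
    \<comment> \<open>Each letter is used once, so all surviving fillings have the same
      sign.\<close>
    then have "length (concat U) = card X"
      by (metis (mono_tags, lifting) distinct_card fillings_def mem_Collect_eq)
    then show "(\<Sum>WW\<in>cutss gt U. (-1) ^ length (concat WW)) =
        (if \<forall>u\<in>set U. successively (\<lambda>x y. \<not> gt x y) u then (-1) ^ card X else 0 :: int)"
      by (simp only: sum_cutss)
  qed
  also have "\<dots> = (-1) ^ card X * int (card (monotone_fillings (\<lambda>x y. \<not> gt x y) X w lam))"
    unfolding monotone_fillings_def
    by (subst sum.inter_filter[symmetric]) (simp_all add: finite_fillings assms mult.commute)
  finally show ?thesis .
qed

section \<open>Induced characters and orbits\<close>

text \<open>For weight 1 this is \<open>proper_colorings_of_type\<close> without the condition on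
  edges. General weights allow functions on orbits.\<close>

definition type_funs :: "'a set \<Rightarrow> ('a \<Rightarrow> nat) \<Rightarrow> nat list \<Rightarrow> ('a \<Rightarrow> nat) set" where
  "type_funs X w \<beta> = {c \<in> X \<rightarrow>\<^sub>E {1..}. \<forall>i<length \<beta>. sum w {x \<in> X. c x = Suc i} = \<beta> ! i}"

text \<open>The classes prescribed by \<open>\<beta>\<close> already use up the total weight, and
  every element has positive weight, so none is left for a value beyond
  \<open>length \<beta>\<close>.\<close>

lemma type_funs_range:
  assumes "finite X" and w: "\<And>x. x \<in> X \<Longrightarrow> w x > 0" and sum: "sum_list \<beta> = sum w X"
    and c: "c \<in> type_funs X w \<beta>" and x: "x \<in> X"
  shows "c x \<in> {1..length \<beta>}"
proof -
  let ?Y = "{x \<in> X. c x \<le> length \<beta>}"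
  have ge1: "1 \<le> c x" if "x \<in> X" for x using c that by (auto simp: type_funs_def)
  have "sum w X = (\<Sum>i<length \<beta>. \<beta> ! i)"
    by (simp add: sum[symmetric] sum_list_sum_nth atLeast0LessThan)
  also have "\<dots> = (\<Sum>i<length \<beta>. sum w {x \<in> ?Y. c x - 1 = i})"
  proof (rule sum.cong[OF refl])
    fix i assume i: "i \<in> {..<length \<beta>}"
    have "{x \<in> ?Y. c x - 1 = i} = {x \<in> X. c x = Suc i}"
      using i ge1 by force
    then show "\<beta> ! i = sum w {x \<in> ?Y. c x - 1 = i}"
      using c i by (simp add: type_funs_def)
  qed
  also have "\<dots> = sum w ?Y"
    using ge1 by (intro sum.group) (force simp: assms)+
  finally have "sum w X = sum w ?Y" .
  moreover have "sum w X = sum w ?Y + sum w (X - ?Y)"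
    using assms(1) by (metis (no_types, lifting) add.commute mem_Collect_eq subsetI sum.subset_diff)
  ultimately have "sum w (X - ?Y) = 0" by simp
  then have "\<forall>a\<in>X - ?Y. w a = 0" using assms(1) by simp
  then have "x \<notin> X - ?Y" using w[OF x] by force
  then show ?thesis using x ge1[OF x] by auto
qed

section \<open>Young subgroups and their cosets\<close>

fun block_index :: "nat list \<Rightarrow> nat \<Rightarrow> nat" where
  "block_index [] x = 0"
| "block_index (a # lam) x = (if x \<le> a then 1 else Suc (block_index lam (x - a)))"

lemma block_index_range:
  "x \<in> {1..sum_list lam} \<Longrightarrow> block_index lam x \<in> {1..length lam}"
proof (induction lam arbitrary: x)
  case (Cons a lam)
  show ?case
  proof (cases "x \<le> a")
    case False
    with Cons.prems have "x - a \<in> {1..sum_list lam}" by auto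
    with Cons.IH[OF this] False show ?thesis by simp
  qed simp
qed simp

lemma young_block_iff_block_index:
  assumes "x \<in> {1..sum_list lam}" "i < length lam"
  shows "x \<in> young_block lam i \<longleftrightarrow> block_index lam x = Suc i"
  using assms
proof (induction lam arbitrary: x i)
  case (Cons a lam)
  show ?case
  proof (cases "x \<le> a")
    case True
    with Cons.prems show ?thesis by (cases i) (auto simp: young_block_def)
  next
    case False
    with Cons.prems(1) have x: "x - a \<in> {1..sum_list lam}" by auto
    show ?thesis
    proof (cases i)
      case 0
      with block_index_range[OF x] False show ?thesis by (auto simp: young_block_def)
    next
      case (Suc j)
      with Cons.prems(2) Cons.IH[OF x, of j]
      have IH: "x - a \<in> young_block lam j \<longleftrightarrow> block_index lam (x - a) = Suc j" by simp
      have "x \<in> young_block (a # lam) i \<longleftrightarrow> x - a \<in> young_block lam j"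
        using False by (auto simp: young_block_def Suc)
      with IH False Suc show ?thesis by simp
    qed
  qed
qed simp

lemma young_block_eq:
  assumes "i < length lam"
  shows "young_block lam i = {x \<in> {1..sum_list lam}. block_index lam x = Suc i}"
proof -
  have "sum_list (take (Suc i) lam) \<le> sum_list lam"
    by (metis append_take_drop_id le_add1 sum_list_append)
  then have "young_block lam i \<subseteq> {1..sum_list lam}"
    by (auto simp: young_block_def)
  with young_block_iff_block_index[OF _ assms] show ?thesis by blast
qed

lemma card_block:
  assumes "i < length lam"
  shows "card {x \<in> {1..sum_list lam}. block_index lam x = Suc i} = lam ! i"
  unfolding young_block_eq[OF assms, symmetric]
  using assms by (simp add: young_block_def take_Suc_conv_app_nth)

lemma block_index_in_type_funs:
  "restrict (block_index lam) {1..sum_list lam} \<in> type_funs {1..sum_list lam} (\<lambda>_. 1) lam"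
proof -
  have "{x \<in> {1..sum_list lam}. restrict (block_index lam) {1..sum_list lam} x = Suc i} =
      {x \<in> {1..sum_list lam}. block_index lam x = Suc i}" for i
    by auto
  then show ?thesis
    using block_index_range[of _ lam] by (auto simp: type_funs_def card_block[simplified])
qed

text \<open>The Young subgroup becomes the stabilizer of the function
  \<open>block_index lam\<close>; this is what identifies its cosets with the functions of type
  \<open>lam\<close>.\<close>

lemma young_subgroup_iff:
  "p \<in> young_subgroup lam \<longleftrightarrow> p permutes {1..sum_list lam} \<and>
     (\<forall>x\<in>{1..sum_list lam}. block_index lam (p x) = block_index lam x)"
proof (intro iffI conjI ballI)
  assume p: "p \<in> young_subgroup lam"
  then show perm: "p permutes {1..sum_list lam}"
    by (simp add: young_subgroup_def sym_group_carrier)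
  fix x assume x: "x \<in> {1..sum_list lam}"
  define i where "i = block_index lam x - 1"
  have i: "i < length lam" "block_index lam x = Suc i"
    using block_index_range[OF x] by (auto simp: i_def)
  then have "x \<in> young_block lam i" using x by (simp add: young_block_eq)
  then have "p x \<in> young_block lam i" using p i(1) by (auto simp: young_subgroup_def)
  then show "block_index lam (p x) = block_index lam x" using i by (simp add: young_block_eq)
next
  assume *: "p permutes {1..sum_list lam} \<and>
     (\<forall>x\<in>{1..sum_list lam}. block_index lam (p x) = block_index lam x)"
  have "p ` young_block lam i = young_block lam i" if i: "i < length lam" for i
  proof (rule card_subset_eq)
    show "finite (young_block lam i)" by (simp add: young_block_def)
    show "p ` young_block lam i \<subseteq> young_block lam i"
      using * i permutes_in_image[of p "{1..sum_list lam}"] by (auto simp: young_block_eq)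
    show "card (p ` young_block lam i) = card (young_block lam i)"
      using * by (intro card_image) (meson inj_on_subset permutes_inj subset_UNIV)
  qed
  with * show "p \<in> young_subgroup lam" by (simp add: young_subgroup_def sym_group_carrier)
qed

text \<open>The symmetric group acts on the functions of type \<open>lam\<close> as on the cosets of
  the Young subgroup. These are the fixed points of \<open>g\<close>, so their number is the value
  of the permutation character at \<open>g\<close>.\<close>

definition invariant_funs :: "(nat \<Rightarrow> nat) \<Rightarrow> nat list \<Rightarrow> (nat \<Rightarrow> nat) set" where
  "invariant_funs g lam =
     {c \<in> type_funs {1..sum_list lam} (\<lambda>_. 1) lam. \<forall>x\<in>{1..sum_list lam}. c (g x) = c x}"

text \<open>Functions of the same type take every value equally often, and functions with equal
  multisets of values differ by a permutation of the arguments.\<close>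

lemma type_funs_transitive:
  assumes c: "c \<in> type_funs {1..sum_list lam} (\<lambda>_. 1) lam"
  obtains p where "p permutes {1..sum_list lam}"
    "\<forall>x\<in>{1..sum_list lam}. block_index lam x = c (p x)"
proof -
  let ?X = "{1..sum_list lam}"
  have eq: "card {x \<in> ?X. block_index lam x = k} = card {x \<in> ?X. c x = k}" for k
  proof (cases "k \<in> {1..length lam}")
    case True
    then obtain i where "k = Suc i" "i < length lam" by (cases k) auto
    with c show ?thesis by (simp add: card_block[simplified] type_funs_def)
  next
    case False
    then have "{x \<in> ?X. block_index lam x = k} = {}"
      using block_index_range[of _ lam] by blast
    moreover have "{x \<in> ?X. c x = k} = {}"
      using False type_funs_range[OF _ _ _ c] by fastforce
    ultimately show ?thesis by (simp only:)
  qed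
  have "image_mset (block_index lam) (mset_set ?X) = image_mset c (mset_set ?X)"
  proof (rule multiset_eqI)
    fix k
    show "count (image_mset (block_index lam) (mset_set ?X)) k = count (image_mset c (mset_set ?X)) k"
      using eq[of k] by (simp add: count_image_mset' eq_commute[of k] conj_commute)
  qed
  from image_mset_eq_implies_permutes[OF _ this] show ?thesis using that by auto
qed

text \<open>The summands of an induced character are indexed by the group elements \<open>x\<close>; grouping them by
  the transported block function \<open>block_index lam \<circ> inv' x\<close> amounts to passing to cosets.\<close>

lemma induced_character_young:
  fixes s :: complex
  assumes g: "g permutes {1..sum_list lam}"
    and \<chi>: "\<And>x. x permutes {1..sum_list lam} \<Longrightarrow> \<chi> (inv' x \<circ> g \<circ> x) = s"
  shows "induced_character (sym_group (sum_list lam)) (young_subgroup lam) \<chi> g =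
           s * of_nat (card (invariant_funs g lam))"
proof -
  define X where "X = {1..sum_list lam}"
  define G where "G = {p. p permutes X}"
  define H where "H = young_subgroup lam"
  define C where "C = type_funs X (\<lambda>_. 1) lam"
  define b where "b = block_index lam"
  \<comment> \<open>The standard block function moved by \<open>x\<close>. It depends only on the
    coset of \<open>x\<close> by \<open>H\<close>, because \<open>H\<close> is the stabilizer of
    \<open>b\<close>.\<close>
  define \<phi> where "\<phi> x = restrict (b \<circ> inv' x) X" for x
  have H: "p \<in> H \<longleftrightarrow> p permutes X \<and> (\<forall>x\<in>X. b (p x) = b x)" for p
    by (simp add: H_def young_subgroup_iff X_def b_def)
  have finG: "finite G" unfolding G_def X_def by (rule finite_permutations) simp
  have HG: "H \<subseteq> G" using H by (auto simp: G_def)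
  have finH: "finite H" using HG finG by (rule finite_subset)
  have "id \<in> H" by (simp add: H permutes_id)
  then have cardH: "card H \<noteq> 0" using finH by auto
  have inX: "p x \<in> X \<longleftrightarrow> x \<in> X" if "p permutes X" for p x
    using permutes_in_image[OF that] .
  have img: "\<phi> ` G = C"
  proof (intro equalityI subsetI)
    fix c assume "c \<in> \<phi> ` G"
    then obtain x where x: "x permutes X" "c = \<phi> x" by (auto simp: G_def)
    have "card {v \<in> X. c v = Suc i} = lam ! i" if i: "i < length lam" for i
    proof -
      have "{v \<in> X. c v = Suc i} = x ` {u \<in> X. b u = Suc i}"
      proof (intro equalityI subsetI)
        fix v assume "v \<in> {v \<in> X. c v = Suc i}"
        then have "inv' x v \<in> {u \<in> X. b u = Suc i}" "v = x (inv' x v)"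
          using x inX[OF permutes_inv[OF x(1)]] by (auto simp: \<phi>_def permutes_inverses)
        then show "v \<in> x ` {u \<in> X. b u = Suc i}" by blast
      next
        fix v assume "v \<in> x ` {u \<in> X. b u = Suc i}"
        then show "v \<in> {v \<in> X. c v = Suc i}"
          using x inX[OF x(1)] by (auto simp: \<phi>_def permutes_inverses)
      qed
      then have "card {v \<in> X. c v = Suc i} = card {u \<in> X. b u = Suc i}"
        by (simp add: card_image inj_on_subset[OF permutes_inj[OF x(1)]])
      then show ?thesis using card_block[OF i] by (simp add: X_def b_def)
    qed
    moreover have "c \<in> X \<rightarrow>\<^sub>E {1..}"
      using block_index_range[of _ lam] inX[OF permutes_inv[OF x(1)]]
      by (auto simp: x(2) \<phi>_def X_def b_def)
    ultimately show "c \<in> C" by (simp add: C_def type_funs_def)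
  next
    fix c assume c: "c \<in> C"
    then obtain x where x: "x permutes X" "\<forall>u\<in>X. b u = c (x u)"
      using type_funs_transitive[of c lam] by (auto simp: C_def X_def b_def)
    have "\<phi> x v = c v" for v
    proof (cases "v \<in> X")
      case True
      then show ?thesis
        using x inX[OF permutes_inv[OF x(1)]] by (simp add: \<phi>_def permutes_inverses)
    next
      case False
      then show ?thesis using c by (auto simp: \<phi>_def C_def type_funs_def PiE_def extensional_def)
    qed
    then have "\<phi> x = c" by blast
    moreover have "x \<in> G" using x(1) by (simp add: G_def)
    ultimately show "c \<in> \<phi> ` G" by blast
  qed
  \<comment> \<open>The fibre over \<open>\<phi> x0\<close> is the coset of \<open>x0\<close>; its
    size cancels the denominator of the induced character.\<close>
  have fibre: "card {x \<in> G. \<phi> x = c} = card H" if "c \<in> C" for c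
  proof -
    from that img obtain x0 where x0: "x0 permutes X" "c = \<phi> x0" by (auto simp: G_def)
    have "{x \<in> G. \<phi> x = c} = (\<lambda>h. x0 \<circ> h) ` H"
    proof (intro equalityI subsetI)
      fix x assume "x \<in> {x \<in> G. \<phi> x = c}"
      then have x: "x permutes X" "\<phi> x = \<phi> x0" by (auto simp: G_def x0)
      have "b (inv' x0 (x u)) = b u" if "u \<in> X" for u
      proof -
        have "b (inv' x0 (x u)) = \<phi> x0 (x u)" using that inX[OF x(1)] by (simp add: \<phi>_def)
        also have "\<dots> = b u"
          using that inX[OF x(1)] by (simp add: x(2)[symmetric]) (simp add: \<phi>_def permutes_inverses[OF x(1)])
        finally show ?thesis .
      qed
      moreover have "inv' x0 \<circ> x permutes X"
        by (rule permutes_compose[OF x(1) permutes_inv[OF x0(1)]])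
      ultimately have "inv' x0 \<circ> x \<in> H" by (simp add: H)
      moreover have "x = x0 \<circ> (inv' x0 \<circ> x)"
        by (simp add: fun_eq_iff permutes_inverses[OF x0(1)])
      ultimately show "x \<in> (\<lambda>h. x0 \<circ> h) ` H" by blast
    next
      fix x assume "x \<in> (\<lambda>h. x0 \<circ> h) ` H"
      then obtain h where h: "h permutes X" "\<forall>u\<in>X. b (h u) = b u" "x = x0 \<circ> h"
        by (auto simp: H)
      have xp: "x permutes X" unfolding h(3) by (rule permutes_compose[OF h(1) x0(1)])
      have "\<phi> x = \<phi> x0"
      proof
        fix v
        show "\<phi> x v = \<phi> x0 v"
        proof (cases "v \<in> X")
          case True
          define u where "u = inv' x v"
          have u: "u \<in> X"
            using True inX[OF permutes_inv[OF xp]] by (simp add: u_def)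
          have "x u = v" by (simp add: u_def permutes_inverses[OF xp])
          then have "v = x0 (h u)" by (simp add: h(3))
          then have "inv' x0 v = h u" by (simp add: permutes_inverses[OF x0(1)])
          then have "b (inv' x0 v) = b (inv' x v)" using u h(2) by (simp add: u_def)
          then show ?thesis using True by (simp add: \<phi>_def)
        qed (simp add: \<phi>_def)
      qed
      with xp x0 show "x \<in> {x \<in> G. \<phi> x = c}" by (simp add: G_def)
    qed
    moreover have "inj_on (\<lambda>h. x0 \<circ> h) H"
    proof (intro inj_onI ext)
      fix h h' v assume "x0 \<circ> h = x0 \<circ> h'"
      then have "x0 (h v) = x0 (h' v)" by (metis comp_apply)
      then show "h v = h' v" using permutes_inj[OF x0(1)] by (simp add: inj_eq)
    qed
    ultimately show ?thesis by (simp add: card_image)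
  qed
  \<comment> \<open>The conjugate of \<open>g\<close> by \<open>x\<close> stabilizes
    \<open>b\<close> exactly if \<open>g\<close> stabilizes the moved function
    \<open>\<phi> x\<close>.\<close>
  have cond: "inv' x \<circ> g \<circ> x \<in> H \<longleftrightarrow> (\<forall>v\<in>X. \<phi> x (g v) = \<phi> x v)" if x: "x permutes X" for x
  proof -
    have gp: "g permutes X" using g by (simp add: X_def)
    have perm: "inv' x \<circ> g \<circ> x permutes X"
      by (intro permutes_compose x gp permutes_inv)
    have "(\<forall>v\<in>X. \<phi> x (g v) = \<phi> x v) \<longleftrightarrow> (\<forall>u\<in>X. \<phi> x (g (x u)) = \<phi> x (x u))"
      using permutes_image[OF x] by (metis (no_types, lifting) image_iff)
    also have "\<dots> \<longleftrightarrow> (\<forall>u\<in>X. b (inv' x (g (x u))) = b u)"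
      using inX[OF x] inX[OF gp] by (simp add: \<phi>_def permutes_inverses[OF x])
    finally show ?thesis using perm by (simp add: H)
  qed
  have "(\<Sum>x\<in>G. if inv' x \<circ> g \<circ> x \<in> H then \<chi> (inv' x \<circ> g \<circ> x) else 0) =
      (\<Sum>x\<in>G. if \<forall>v\<in>X. \<phi> x (g v) = \<phi> x v then s else 0)"
  proof (rule sum.cong[OF refl])
    fix x assume "x \<in> G"
    then have x: "x permutes X" by (simp add: G_def)
    show "(if inv' x \<circ> g \<circ> x \<in> H then \<chi> (inv' x \<circ> g \<circ> x) else 0) =
        (if \<forall>v\<in>X. \<phi> x (g v) = \<phi> x v then s else 0)"
      unfolding cond[OF x] \<chi>[OF x[unfolded X_def]] ..
  qed
  also have "\<dots> = (\<Sum>c\<in>C. \<Sum>x\<in>{x \<in> G. \<phi> x = c}. if \<forall>v\<in>X. \<phi> x (g v) = \<phi> x v then s else 0)"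
    unfolding img[symmetric] by (rule sum.image_gen[OF finG])
  also have "\<dots> = (\<Sum>c\<in>C. if \<forall>v\<in>X. c (g v) = c v then of_nat (card H) * s else 0)"
  proof (rule sum.cong[OF refl])
    fix c assume c: "c \<in> C"
    have "(\<Sum>x\<in>{x \<in> G. \<phi> x = c}. if \<forall>v\<in>X. \<phi> x (g v) = \<phi> x v then s else 0) =
        (\<Sum>x\<in>{x \<in> G. \<phi> x = c}. if \<forall>v\<in>X. c (g v) = c v then s else 0)"
      by (rule sum.cong) auto
    also have "\<dots> = of_nat (card H) * (if \<forall>v\<in>X. c (g v) = c v then s else 0)"
      by (simp only: sum_constant fibre[OF c])
    finally show "(\<Sum>x\<in>{x \<in> G. \<phi> x = c}. if \<forall>v\<in>X. \<phi> x (g v) = \<phi> x v then s else 0) =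
        (if \<forall>v\<in>X. c (g v) = c v then of_nat (card H) * s else 0)"
      by (simp only: if_distrib mult_zero_right)
  qed
  also have "\<dots> = of_nat (card {c \<in> C. \<forall>v\<in>X. c (g v) = c v}) * (of_nat (card H) * s)"
  proof -
    have "finite C" using finG unfolding img[symmetric] by (rule finite_imageI)
    then show ?thesis by (simp only: sum.inter_filter[symmetric] sum_constant)
  qed
  finally have "(\<Sum>x\<in>G. if inv' x \<circ> g \<circ> x \<in> H then \<chi> (inv' x \<circ> g \<circ> x) else 0) / of_nat (card H) =
      s * of_nat (card {c \<in> C. \<forall>v\<in>X. c (g v) = c v})"
    using cardH by simp
  moreover have "induced_character (sym_group (sum_list lam)) (young_subgroup lam) \<chi> g =
      (\<Sum>x\<in>G. if inv' x \<circ> g \<circ> x \<in> H then \<chi> (inv' x \<circ> g \<circ> x) else 0) / of_nat (card H)"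
  proof -
    have carrier: "carrier (sym_group (sum_list lam)) = G"
      by (simp add: G_def X_def sym_group_def)
    have "inv\<^bsub>sym_group (sum_list lam)\<^esub> x = inv' x" if "x \<in> G" for x
      using that carrier by simp
    then show ?thesis
      unfolding induced_character_def carrier
      by (simp add: Let_def sym_group_mult H_def[symmetric])
  qed
  ultimately show ?thesis by (simp add: invariant_funs_def C_def X_def)
qed

lemma eta_character_eq:
  assumes "g permutes {1..sum_list lam}"
  shows "eta_character lam g = of_nat (card (invariant_funs g lam))"
  unfolding eta_character_def by (subst induced_character_young[OF assms, of _ 1]) auto

text \<open>All conjugates of \<open>g\<close> have the sign of \<open>g\<close>, which therefore
  comes out of the sum.\<close>

lemma eps_character_eq:
  assumes "g permutes {1..sum_list lam}"
  shows "eps_character lam g = of_int (sign g) * of_nat (card (invariant_funs g lam))"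
  unfolding eps_character_def
proof (rule induced_character_young[OF assms])
  fix x assume x: "x permutes {1..sum_list lam}"
  have perm: "permutation x" "permutation g" "permutation (inv' x)"
    using x assms permutes_inv[OF x] by (auto simp: permutation_permutes)
  show "complex_of_int (sign (inv' x \<circ> g \<circ> x)) = of_int (sign g)"
    using perm by (simp add: sign_compose permutation_compose sign_inverse mult.commute
        mult.left_commute)
qed

text \<open>Orbits enter only through the functions that are constant on them. In the induction
  \<open>p\<close> is \<open>transpose a b \<circ> q\<close> with \<open>q\<close> fixing
  \<open>a\<close>. For \<open>b = a\<close> a new orbit appears; otherwise \<open>a\<close> is
  spliced into the cycle of \<open>b\<close>, which keeps the number of orbits and flips the sign.
  Only the parity of the exponent matters, so the number of orbits is added instead of
  subtracted.\<close>

lemma ex_orbit_map: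
  assumes "finite X" "p permutes X"
  obtains ob where "ob ` X \<subseteq> X" "sign p = (-1) ^ (card X + card (ob ` X))"
    "\<And>c :: 'a \<Rightarrow> nat. (\<forall>x\<in>X. c (p x) = c x) \<longleftrightarrow> (\<forall>x\<in>X. \<forall>y\<in>X. ob x = ob y \<longrightarrow> c x = c y)"
  using assms
proof (induction X arbitrary: p thesis rule: finite_induct)
  case empty
  from empty.prems(2) have "p = id" by simp
  then show ?case by (intro empty.prems(1)[of id]) auto
next
  case (insert a X)
  have "p \<in> {p. p permutes insert a X}" using insert.prems(2) by simp
  then obtain b q where p: "p = transpose a b \<circ> q" "b \<in> insert a X" "q permutes X"
    unfolding permutes_insert by (elim imageE CollectE case_prodE) simp
  obtain ob where ob: "ob ` X \<subseteq> X"
    "sign q = (-1) ^ (card X + card (ob ` X))"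
    "\<And>c :: 'a \<Rightarrow> nat. (\<forall>x\<in>X. c (q x) = c x) \<longleftrightarrow> (\<forall>x\<in>X. \<forall>y\<in>X. ob x = ob y \<longrightarrow> c x = c y)"
    by (rule insert.IH[OF _ p(3)]) (rule that)
  have qa: "q a = a" using p(3) insert.hyps by (simp add: permutes_not_in)
  have perm: "permutation q" "permutation (transpose a b)"
    by (rule permutes_imp_permutation[OF insert.hyps(1) p(3)], rule permutation_swap_id)
  have qX: "q x \<in> X \<longleftrightarrow> x \<in> X" for x using permutes_in_image[OF p(3)] .
  show ?case
  proof (cases "b = a")
    case True
    let ?ob = "ob(a := a)"
    have img: "?ob ` insert a X = insert a (ob ` X)" using insert.hyps by auto
    have "a \<notin> ob ` X" using ob(1) insert.hyps by auto
    then have card: "card (?ob ` insert a X) = Suc (card (ob ` X))"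
      unfolding img using insert.hyps by simp
    have pq: "p = q" using p(1) True by simp
    show ?thesis
    proof (rule insert.prems(1)[of ?ob])
      show "?ob ` insert a X \<subseteq> insert a X" unfolding img using ob(1) by auto
      show "sign p = (-1) ^ (card (insert a X) + card (?ob ` insert a X))"
        unfolding card pq ob(2) using insert.hyps by simp
      fix c :: "'a \<Rightarrow> nat"
      have "(\<forall>x\<in>insert a X. c (p x) = c x) \<longleftrightarrow> (\<forall>x\<in>X. c (q x) = c x)"
        by (simp add: pq qa)
      also have "\<dots> \<longleftrightarrow> (\<forall>x\<in>insert a X. \<forall>y\<in>insert a X. ?ob x = ?ob y \<longrightarrow> c x = c y)"
        unfolding ob(3)
      proof (intro iffI ballI impI)
        fix x y
        assume *: "\<forall>x\<in>X. \<forall>y\<in>X. ob x = ob y \<longrightarrow> c x = c y"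
          and xy: "x \<in> insert a X" "y \<in> insert a X" "?ob x = ?ob y"
        have ne: "ob z \<noteq> a" if "z \<in> X" for z using that \<open>a \<notin> ob ` X\<close> by blast
        show "c x = c y"
        proof (cases "x = a \<or> y = a")
          case True
          with xy ne[of x] ne[of y] have "x = y" by (cases "x = a"; cases "y = a") auto
          then show ?thesis by simp
        next
          case False
          with xy *[rule_format, of x y] show ?thesis by simp
        qed
      next
        fix x y
        assume *: "\<forall>x\<in>insert a X. \<forall>y\<in>insert a X. ?ob x = ?ob y \<longrightarrow> c x = c y"
          and xy: "x \<in> X" "y \<in> X" "ob x = ob y"
        from xy(1,2) insert.hyps have "x \<noteq> a" "y \<noteq> a" by auto
        with xy *[rule_format, of x y] show "c x = c y" by simp
      qed
      finally show "(\<forall>x\<in>insert a X. c (p x) = c x) \<longleftrightarrow>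
        (\<forall>x\<in>insert a X. \<forall>y\<in>insert a X. ?ob x = ?ob y \<longrightarrow> c x = c y)" .
    qed
  next
    case False
    with p(2) have bX: "b \<in> X" by simp
    let ?ob = "ob(a := ob b)"
    have img: "?ob ` insert a X = ob ` X" using insert.hyps bX by auto
    \<comment> \<open>The point that \<open>q\<close> sends to \<open>b\<close>; the cycle of
      \<open>p\<close> runs from \<open>y\<close> through \<open>a\<close> to
      \<open>b\<close>.\<close>
    define y where "y = inv' q b"
    have y: "y \<in> X" "q y = b"
      unfolding y_def permutes_inverses(1)[OF p(3)] permutes_in_image[OF permutes_inv[OF p(3)]]
      by (rule bX refl)+
    have py: "p y = a" "p a = b" using y(2) qa by (simp_all add: p(1))
    have px: "p x = q x" if "x \<in> X" "x \<noteq> y" for x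
    proof -
      have "q x \<noteq> b" using that(2) y(2) permutes_inj[OF p(3)] by (metis injD)
      moreover have "q x \<noteq> a" using that(1) qX[of x] insert.hyps(2) by metis
      ultimately show ?thesis by (simp add: p(1))
    qed
    show ?thesis
    proof (rule insert.prems(1)[of ?ob])
      show "?ob ` insert a X \<subseteq> insert a X" unfolding img using ob(1) by auto
      have "sign p = - sign q"
        unfolding p(1) using perm False by (simp add: sign_compose sign_swap_id)
      then show "sign p = (-1) ^ (card (insert a X) + card (?ob ` insert a X))"
        unfolding img ob(2) using insert.hyps by simp
      fix c :: "'a \<Rightarrow> nat"
      have "(\<forall>x\<in>insert a X. c (p x) = c x) \<longleftrightarrow> c a = c b \<and> (\<forall>x\<in>X. c (q x) = c x)"
      proof (intro iffI conjI ballI; (elim conjE)?)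
        assume *: "\<forall>x\<in>insert a X. c (p x) = c x"
        from *[rule_format, of a] py show ab: "c a = c b" by simp
        fix x assume x: "x \<in> X"
        show "c (q x) = c x"
        proof (cases "x = y")
          case True
          with *[rule_format, of y] py y ab show ?thesis by simp
        next
          case False
          with *[rule_format, of x] px[OF x] x show ?thesis by simp
        qed
      next
        fix x assume *: "c a = c b" "\<forall>x\<in>X. c (q x) = c x" and x: "x \<in> insert a X"
        show "c (p x) = c x"
        proof -
          consider "x = a" | "x = y" | "x \<in> X" "x \<noteq> y" using x by blast
          then show ?thesis
          proof cases
            case 1
            then show ?thesis using py *(1) by simp
          next
            case 2
            then show ?thesis using py(1) *(1) *(2)[rule_format, OF y(1)] y(2) by simp
          next
            case 3
            then show ?thesis using px *(2) by simp
          qed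
        qed
      qed
      also have "\<dots> \<longleftrightarrow> (\<forall>x\<in>insert a X. \<forall>y\<in>insert a X. ?ob x = ?ob y \<longrightarrow> c x = c y)"
        unfolding ob(3)
      proof (intro iffI ballI impI conjI; (elim conjE)?)
        fix x y
        assume *: "c a = c b" "\<forall>x\<in>X. \<forall>y\<in>X. ob x = ob y \<longrightarrow> c x = c y"
          and xy: "x \<in> insert a X" "y \<in> insert a X" "?ob x = ?ob y"
        \<comment> \<open>Trades \<open>a\<close> for \<open>b\<close>, which has the same orbit
          label and the same value, so that the condition on \<open>X\<close> applies.\<close>
        define f where "f z = (if z = a then b else z)" for z
        have f: "f z \<in> X \<and> ?ob z = ob (f z) \<and> c z = c (f z)" if "z \<in> insert a X" for z
          using that bX *(1) by (auto simp: f_def)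
        have "ob (f x) = ob (f y)" using f[OF xy(1)] f[OF xy(2)] xy(3) by metis
        then have "c (f x) = c (f y)" using f[OF xy(1)] f[OF xy(2)] *(2) by blast
        then show "c x = c y" using f[OF xy(1)] f[OF xy(2)] by metis
      next
        assume *: "\<forall>x\<in>insert a X. \<forall>y\<in>insert a X. ?ob x = ?ob y \<longrightarrow> c x = c y"
        from *[rule_format, of a b] bX False show "c a = c b" by simp
        fix x y assume "x \<in> X" "y \<in> X" "ob x = ob y"
        moreover from this(1,2) insert.hyps have "x \<noteq> a" "y \<noteq> a" by auto
        ultimately show "c x = c y" using *[rule_format, of x y] by simp
      qed
      finally show "(\<forall>x\<in>insert a X. c (p x) = c x) \<longleftrightarrow>
        (\<forall>x\<in>insert a X. \<forall>y\<in>insert a X. ?ob x = ?ob y \<longrightarrow> c x = c y)" .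
    qed
  qed
qed

text \<open>A new point \<open>a\<close> is spliced into a cycle directly after some
  \<open>y\<close> of its own class, or stays fixed if its class is new; in this way the classes of
  \<open>b\<close> become the orbits. The lemma serves to realize every cycle type.\<close>

lemma ex_permutes_with_orbits:
  assumes "finite X"
  obtains p where "p permutes X" "\<And>x. x \<in> X \<Longrightarrow> b (p x) = b x"
    "\<And>c x y. \<lbrakk>\<forall>x\<in>X. c (p x) = c x; x \<in> X; y \<in> X; b x = b y\<rbrakk> \<Longrightarrow> (c x :: nat) = c y"
  using assms
proof (induction X arbitrary: thesis rule: finite_induct)
  case empty
  show ?case by (rule empty(1)[of id]) (auto simp: permutes_id)
next
  case (insert a X)
  obtain p where p: "p permutes X" "\<And>x. x \<in> X \<Longrightarrow> b (p x) = b x"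
    "\<And>c x y. \<lbrakk>\<forall>x\<in>X. c (p x) = c x; x \<in> X; y \<in> X; b x = b y\<rbrakk> \<Longrightarrow> (c x :: nat) = c y"
    using insert.IH by blast
  have pa: "p a = a" using p(1) insert.hyps by (simp add: permutes_not_in)
  show ?case
  proof (cases "b a \<in> b ` X")
    case False
    show ?thesis
    proof (rule insert.prems[of p])
      show "p permutes insert a X" using p(1) by (rule permutes_subset) auto
      show "b (p x) = b x" if "x \<in> insert a X" for x using that p(2) pa by auto
      fix c :: "_ \<Rightarrow> nat" and x y
      assume "\<forall>x\<in>insert a X. c (p x) = c x" "x \<in> insert a X" "y \<in> insert a X" "b x = b y"
      with False p(3)[of c x y] show "c x = c y" by (metis image_eqI insertE insertI2)
    qed
  next
    case True
    then obtain y where y: "y \<in> X" "b y = b a" by auto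
    define q where "q = p \<circ> transpose a y"
    have ya: "y \<noteq> a" using y insert.hyps by auto
    have qa: "q a = p y" "q y = a" using pa by (auto simp: q_def)
    have qx: "q x = p x" if "x \<in> X" "x \<noteq> y" for x
      using that insert.hyps by (auto simp: q_def transpose_def)
    show ?thesis
    proof (rule insert.prems[of q])
      show "q permutes insert a X" unfolding q_def
        by (intro permutes_compose permutes_swap_id permutes_subset[OF p(1)]) (use y in auto)
      show "b (q x) = b x" if x: "x \<in> insert a X" for x
      proof -
        consider "x = a" | "x = y" | "x \<in> X" "x \<noteq> y" using x by auto
        then show ?thesis
        proof cases
          case 1
          then show ?thesis using p(2)[OF y(1)] qa y(2) by simp
        next
          case 2
          then show ?thesis using qa y(2) by simp
        next
          case 3
          then show ?thesis using p(2) qx by simp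
        qed
      qed
      fix c :: "_ \<Rightarrow> nat" and x z
      assume c: "\<forall>x\<in>insert a X. c (q x) = c x" and xz: "x \<in> insert a X" "z \<in> insert a X" "b x = b z"
      have cay: "c a = c y" using c[rule_format, of y] qa y by simp
      have "\<forall>x\<in>X. c (p x) = c x" 
      proof
        fix x assume x: "x \<in> X"
        show "c (p x) = c x"
        proof (cases "x = y")
          case True
          with c[rule_format, of a] qa cay show ?thesis by simp
        next
          case False
          with c[rule_format, of x] qx[OF x] x show ?thesis by simp
        qed
      qed
      then have const: "\<And>u v. \<lbrakk>u \<in> X; v \<in> X; b u = b v\<rbrakk> \<Longrightarrow> c u = c v" using p(3) by blast
      show "c x = c z"
      proof -
        define f where "f u = (if u = a then y else u)" for u
        have f: "f u \<in> X \<and> b u = b (f u) \<and> c u = c (f u)" if "u \<in> insert a X" for u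
          using that y cay by (auto simp: f_def)
        have "b (f x) = b (f z)" using f[OF xz(1)] f[OF xz(2)] xz(3) by metis
        then have "c (f x) = c (f z)" using f[OF xz(1)] f[OF xz(2)] const by blast
        then show ?thesis using f[OF xz(1)] f[OF xz(2)] by metis
      qed
    qed
  qed
qed

section \<open>Colorings and fillings\<close>

text \<open>Disjointness by \<open>sorted_wrt\<close> follows the recursion of
  \<open>distinct (concat U)\<close>, so that fillings are exactly arrangements of these set
  partitions into words.\<close>

definition set_partitions :: "'a set \<Rightarrow> ('a \<Rightarrow> nat) \<Rightarrow> nat list \<Rightarrow> 'a set list set" where
  "set_partitions X w \<beta> =
     {As. map (sum w) As = \<beta> \<and> \<Union>(set As) = X \<and> sorted_wrt (\<lambda>A B. A \<inter> B = {}) As}"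

lemma sorted_wrt_disjoint_iff:
  "sorted_wrt (\<lambda>A B. A \<inter> B = {}) As \<longleftrightarrow>
     (\<forall>i<length As. \<forall>j<length As. i \<noteq> j \<longrightarrow> As ! i \<inter> As ! j = {})"
proof
  assume *: "sorted_wrt (\<lambda>A B. A \<inter> B = {}) As"
  show "\<forall>i<length As. \<forall>j<length As. i \<noteq> j \<longrightarrow> As ! i \<inter> As ! j = {}"
  proof (intro allI impI)
    fix i j assume ij: "i < length As" "j < length As" "i \<noteq> j"
    consider "i < j" | "j < i" using ij(3) by linarith
    then show "As ! i \<inter> As ! j = {}"
    proof cases
      case 1
      then show ?thesis using sorted_wrt_nth_less[OF * 1 ij(2)] by simp
    next
      case 2
      then show ?thesis using sorted_wrt_nth_less[OF * 2 ij(1)] by (simp add: Int_commute)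
    qed
  qed
qed (simp add: sorted_wrt_iff_nth_less)

lemma ordered_set_partitions_eq: "ordered_set_partitions X lam = set_partitions X (\<lambda>_. 1) lam"
proof -
  have "sum (\<lambda>_. 1) = (card :: 'a set \<Rightarrow> nat)" by (rule ext) simp
  then show ?thesis
    unfolding ordered_set_partitions_def set_partitions_def sorted_wrt_disjoint_iff by (simp only:)
qed

lemma distinct_concat_iff_disjoint:
  "distinct (concat U) \<longleftrightarrow>
     (\<forall>u\<in>set U. distinct u) \<and> sorted_wrt (\<lambda>A B. A \<inter> B = {}) (map set U)"
  by (induction U) auto

lemma fillings_iff_set_partitions:
  "U \<in> fillings X w \<beta> \<longleftrightarrow> (\<forall>u\<in>set U. distinct u) \<and> map set U \<in> set_partitions X w \<beta>"
proof -
  have "map (wt w) U = map (sum w) (map set U)" if "\<forall>u\<in>set U. distinct u"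
    using that by (auto simp: wt_distinct)
  then show ?thesis
    unfolding fillings_def set_partitions_def distinct_concat_iff_disjoint by auto
qed

text \<open>Bijections between rows with a fixed underlying set, one for each set, glue to a
  bijection between lists of rows. Here \<open>k\<close> and \<open>k'\<close> extract the
  underlying set of a row, and \<open>S\<close> holds the admissible sequences of such sets.\<close>

lemma card_lists_eq_of_fibres:
  assumes fib: "\<And>I. I \<in> T \<Longrightarrow> \<exists>f. bij_betw f {u \<in> A. k u = I} {v \<in> B. k' v = I}"
    and S: "S \<subseteq> lists T"
  shows "card {U \<in> lists A. map k U \<in> S} = card {V \<in> lists B. map k' V \<in> S}"
proof -
  have "\<exists>F. \<forall>I\<in>T. bij_betw (F I) {u \<in> A. k u = I} {v \<in> B. k' v = I}"
    using fib by (intro bchoice) blast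
  then obtain F where F: "\<And>I. I \<in> T \<Longrightarrow> bij_betw (F I) {u \<in> A. k u = I} {v \<in> B. k' v = I}"
    by blast
  \<comment> \<open>The bijection is selected by the underlying set of its argument and preserves
    that set, so different choices cannot collide.\<close>
  define f where "f u = F (k u) u" for u
  define A' where "A' = {u \<in> A. k u \<in> T}"
  define B' where "B' = {v \<in> B. k' v \<in> T}"
  have f: "f u \<in> B \<and> k' (f u) = k u" if "u \<in> A'" for u
    using bij_betwE[OF F[of "k u"]] that by (auto simp: f_def A'_def)
  have inj: "inj_on f A'"
  proof (rule inj_onI)
    fix u v assume uv: "u \<in> A'" "v \<in> A'" "f u = f v"
    then have eq: "k u = k v" using f by metis
    have "inj_on (F (k u)) {x \<in> A. k x = k u}"
      using F uv(1) by (auto simp: A'_def bij_betw_def)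
    then show "u = v" using uv eq by (auto simp: f_def A'_def dest: inj_onD)
  qed
  have img: "f ` A' = B'"
  proof (intro equalityI subsetI)
    fix v assume "v \<in> f ` A'"
    then show "v \<in> B'" using f by (auto simp: A'_def B'_def)
  next
    fix v assume v: "v \<in> B'"
    then have "F (k' v) ` {u \<in> A. k u = k' v} = {x \<in> B. k' x = k' v}"
      using F by (auto simp: B'_def bij_betw_def)
    then have "v \<in> F (k' v) ` {u \<in> A. k u = k' v}" using v by (auto simp: B'_def)
    then obtain u where u: "u \<in> A" "k u = k' v" "v = F (k' v) u" by blast
    then have "v = f u" by (simp only: f_def)
    moreover have "u \<in> A'" using u(1,2) v by (simp add: A'_def B'_def)
    ultimately show "v \<in> f ` A'" by blast
  qed
  have "bij_betw (map f) {U \<in> lists A. map k U \<in> S} {V \<in> lists B. map k' V \<in> S}"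
  proof (rule bij_betw_imageI)
    have sub: "set U \<subseteq> A'" if "U \<in> {U \<in> lists A. map k U \<in> S}" for U
      using that S by (fastforce simp: A'_def in_lists_conv_set)
    show "inj_on (map f) {U \<in> lists A. map k U \<in> S}"
    proof (rule inj_onI)
      fix U V assume "U \<in> {U \<in> lists A. map k U \<in> S}" "V \<in> {U \<in> lists A. map k U \<in> S}"
        and eq: "map f U = map f V"
      then have "set U \<union> set V \<subseteq> A'" using sub by blast
      then have "inj_on f (set U \<union> set V)" using inj inj_on_subset by blast
      with eq show "U = V" by (rule map_inj_on)
    qed
    show "map f ` {U \<in> lists A. map k U \<in> S} = {V \<in> lists B. map k' V \<in> S}"
    proof (intro equalityI subsetI)
      fix V assume "V \<in> map f ` {U \<in> lists A. map k U \<in> S}"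
      then obtain U where U: "V = map f U" "U \<in> {U \<in> lists A. map k U \<in> S}" by blast
      have "map k' V = map k U" unfolding U(1) using sub[OF U(2)] f by auto
      moreover have "set V \<subseteq> B" unfolding U(1) set_map using sub[OF U(2)] f by blast
      then have "V \<in> lists B" by auto
      ultimately show "V \<in> {V \<in> lists B. map k' V \<in> S}" using U(2) by simp
    next
      fix V assume V: "V \<in> {V \<in> lists B. map k' V \<in> S}"
      then have "set V \<subseteq> f ` A'" unfolding img using S by (fastforce simp: B'_def in_lists_conv_set)
      then have "V \<in> map f ` lists A'" unfolding lists_image[symmetric] by blast
      then obtain U where U: "set U \<subseteq> A'" "V = map f U" by blast
      have "map k' V = map k U" unfolding U(2) using U(1) f by auto
      with V have "map k U \<in> S" by simp
      moreover have "U \<in> lists A" using U(1) by (auto simp: A'_def)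
      ultimately show "V \<in> map f ` {U \<in> lists A. map k U \<in> S}"
        unfolding U(2) by blast
    qed
  qed
  then show ?thesis by (rule bij_betw_same_card)
qed

text \<open>If the first letters differed, each would occur later in the other list, and the two
  would be related in both directions.\<close>

lemma sorted_wrt_set_unique:
  assumes "transp R" "irreflp R"
    and "sorted_wrt R u" "sorted_wrt R v" "set u = set v"
  shows "u = v"
  using assms(3-)
proof (induction u arbitrary: v)
  case (Cons x u)
  then obtain y v' where v: "v = y # v'" by (cases v) auto
  have xy: "x = y"
  proof (rule ccontr)
    assume "x \<noteq> y"
    with Cons.prems v have "x \<in> set v'" "y \<in> set u" by auto
    with Cons.prems v have "R x y" "R y x" by auto
    with assms(1,2) show False by (meson irreflpD transpD)
  qed
  have "x \<notin> set u" "x \<notin> set v'"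
    using Cons.prems v xy assms(2) by (auto dest: irreflpD)
  with Cons.prems(3) v xy have "set u = set v'" by auto
  with Cons.IH[of v'] Cons.prems v xy show ?case by simp
qed simp

text \<open>A new element \<open>a\<close> goes behind the elements that are related to it. By
  totality it precedes all others, and transitivity takes care of the pairs across
  \<open>a\<close>.\<close>

lemma ex_sorted_wrt_chain:
  assumes "transp R" "finite A" "\<And>x y. \<lbrakk>x \<in> A; y \<in> A; x \<noteq> y\<rbrakk> \<Longrightarrow> R x y \<or> R y x"
  shows "\<exists>u. distinct u \<and> set u = A \<and> sorted_wrt R u"
  using assms(2,3)
proof (induction A rule: finite_induct)
  case (insert a A)
  have "\<exists>u. distinct u \<and> set u = A \<and> sorted_wrt R u"
    by (rule insert.IH) (use insert.prems in blast)
  then obtain u where u: "distinct u" "set u = A" "sorted_wrt R u" by blast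
  let ?u1 = "filter (\<lambda>x. R x a) u" and ?u2 = "filter (\<lambda>x. \<not> R x a) u"
  have gt2: "R a y" if "y \<in> set ?u2" for y
  proof -
    from that u(2) have "y \<in> A" "\<not> R y a" by simp_all
    with insert.prems[of a y] insert.hyps(2) show ?thesis by blast
  qed
  have "R x y" if "x \<in> set ?u1" "y \<in> set ?u2" for x y
  proof -
    from that(1) have "R x a" by simp
    then show ?thesis using gt2[OF that(2)] by (rule transpD[OF assms(1)])
  qed
  moreover have "sorted_wrt R ?u1" "sorted_wrt R ?u2"
    using u(3) by (rule sorted_wrt_filter)+
  moreover have "\<forall>x\<in>set ?u1. R x a" by simp
  ultimately have "sorted_wrt R (?u1 @ a # ?u2)"
    using gt2 unfolding sorted_wrt_append sorted_wrt.simps set_simps by blast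
  moreover have "distinct (?u1 @ a # ?u2)" "set (?u1 @ a # ?u2) = insert a A"
    using u(1,2) insert.hyps(2) by auto
  ultimately show ?case by blast
qed simp

definition is_chain :: "('a \<Rightarrow> 'a \<Rightarrow> bool) \<Rightarrow> 'a set \<Rightarrow> bool" where
  "is_chain R A \<longleftrightarrow> (\<forall>x\<in>A. \<forall>y\<in>A. x = y \<or> R x y \<or> R y x)"

lemma is_chain_set_if_sorted_wrt: "sorted_wrt R u \<Longrightarrow> is_chain R (set u)"
  by (induction u) (auto simp: is_chain_def)

text \<open>For a transitive relation a monotone row is sorted throughout, and a chain has just one
  sorted arrangement. So a row carries no more information than its set.\<close>

lemma card_monotone_fillings_eq_set_partitions:
  assumes "finite X" "transp R" "irreflp R"
  shows "card (monotone_fillings R X w \<beta>) =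
           card {As \<in> set_partitions X w \<beta>. \<forall>A\<in>set As. is_chain R A}"
proof -
  have "monotone_fillings R X w \<beta> =
      {U \<in> lists {u. distinct u \<and> sorted_wrt R u}. map set U \<in> set_partitions X w \<beta>}"
    by (auto simp: monotone_fillings_def fillings_iff_set_partitions
        successively_conv_sorted_wrt[OF assms(2)])
  also have "card \<dots> = card {As \<in> lists {A. is_chain R A}. map id As \<in> set_partitions X w \<beta>}"
  proof (rule card_lists_eq_of_fibres[where T = "Pow X"])
    show "set_partitions X w \<beta> \<subseteq> lists (Pow X)"
      by (auto simp: set_partitions_def)
    fix I assume "I \<in> Pow X"
    then have fin: "finite I" using assms(1) finite_subset by auto
    let ?A = "{u \<in> {u. distinct u \<and> sorted_wrt R u}. set u = I}"
    let ?B = "{A \<in> {A. is_chain R A}. id A = I}"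
    have "inj_on set ?A"
      by (rule inj_onI) (auto intro: sorted_wrt_set_unique[OF assms(2,3)])
    moreover have "set ` ?A = ?B"
    proof (intro equalityI subsetI)
      fix A assume "A \<in> ?B"
      with ex_sorted_wrt_chain[OF assms(2) fin] show "A \<in> set ` ?A"
        by (force simp: is_chain_def)
    qed (auto intro: is_chain_set_if_sorted_wrt)
    ultimately show "\<exists>f. bij_betw f ?A ?B" unfolding bij_betw_def by blast
  qed
  also have "{As \<in> lists {A. is_chain R A}. map id As \<in> set_partitions X w \<beta>} =
      {As \<in> set_partitions X w \<beta>. \<forall>A\<in>set As. is_chain R A}"
    by auto
  finally show ?thesis .
qed

lemma card_type_funs_eq_set_partitions:
  assumes "finite X" "\<And>x. x \<in> X \<Longrightarrow> w x > 0" "sum_list \<beta> = sum w X"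
  shows "card {c \<in> type_funs X w \<beta>. \<forall>x\<in>X. \<forall>y\<in>X. c x = c y \<longrightarrow> x = y \<or> R x y \<or> R y x} =
           card {As \<in> set_partitions X w \<beta>. \<forall>A\<in>set As. is_chain R A}"
    (is "card ?C = card ?P")
proof -
  let ?l = "length \<beta>"
  define f where "f c = map (\<lambda>i. {x \<in> X. c x = Suc i}) [0..<?l]" for c :: "'a \<Rightarrow> nat"
  have len: "length (f c) = ?l" for c by (simp add: f_def)
  have nth: "f c ! i = {x \<in> X. c x = Suc i}" if "i < ?l" for c i using that by (simp add: f_def)
  have range: "\<exists>i<?l. c x = Suc i" if "c \<in> type_funs X w \<beta>" "x \<in> X" for c x
    using type_funs_range[OF assms that] by (cases "c x") auto
  have "bij_betw f ?C ?P"
  proof (rule bij_betw_imageI)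
    show "inj_on f ?C"
    proof (rule inj_onI)
      fix c d assume c: "c \<in> ?C" and d: "d \<in> ?C" and eq: "f c = f d"
      show "c = d"
      proof
        fix x
        show "c x = d x"
        proof (cases "x \<in> X")
          case True
          then obtain i where i: "i < ?l" "c x = Suc i" using range[of c x] c by blast
          then have "x \<in> f d ! i" using True by (simp add: eq[symmetric] nth)
          with i show ?thesis by (simp add: nth)
        next
          case False
          then show ?thesis using c d by (auto simp: type_funs_def PiE_def extensional_def)
        qed
      qed
    qed
    show "f ` ?C = ?P"
    proof (intro equalityI subsetI)
      fix As assume "As \<in> f ` ?C"
      then obtain c where c: "c \<in> ?C" "As = f c" by blast
      have "map (sum w) As = \<beta>"
        using c by (intro nth_equalityI) (auto simp: len nth type_funs_def)
      moreover have "\<Union>(set As) = X"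
      proof (intro equalityI subsetI)
        fix x assume x: "x \<in> X"
        with range[of c x] c obtain i where "i < ?l" "c x = Suc i" by blast
        with x show "x \<in> \<Union>(set As)" by (auto simp: c(2) f_def)
      next
        fix x assume "x \<in> \<Union>(set As)"
        then show "x \<in> X" unfolding c(2) f_def by auto
      qed
      moreover have "sorted_wrt (\<lambda>A B. A \<inter> B = {}) As"
        unfolding sorted_wrt_disjoint_iff c(2) by (auto simp: len nth)
      moreover have "\<forall>A\<in>set As. is_chain R A"
        using c by (auto simp: f_def is_chain_def)
      ultimately show "As \<in> ?P" by (simp add: set_partitions_def)
    next
      fix As assume As: "As \<in> ?P"
      then have wAs: "map (sum w) As = \<beta>" and UAs: "\<Union>(set As) = X"
        by (simp_all add: set_partitions_def)
      from wAs have lenAs: "length As = ?l" by (metis length_map)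
      have sub: "As ! i \<subseteq> X" if "i < ?l" for i
      proof -
        from that lenAs have "As ! i \<in> set As" by simp
        then show ?thesis using UAs by blast
      qed
      \<comment> \<open>By disjointness only one index qualifies, and \<open>LEAST\<close> merely
        names it. Colors start at 1, hence \<open>Suc\<close>.\<close>
      define c where "c = (\<lambda>x\<in>X. Suc (LEAST i. i < ?l \<and> x \<in> As ! i))"
      have c: "c x = Suc i" if "i < ?l" "x \<in> As ! i" for x i
      proof -
        have "(LEAST i. i < ?l \<and> x \<in> As ! i) = i"
        proof (rule Least_equality)
          fix j assume "j < ?l \<and> x \<in> As ! j"
          then have j: "j < length As" "x \<in> As ! j" unfolding lenAs by blast+
          have "\<forall>i<length As. \<forall>j<length As. i \<noteq> j \<longrightarrow> As ! i \<inter> As ! j = {}"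
            using As unfolding set_partitions_def sorted_wrt_disjoint_iff by blast
          then have "As ! i \<inter> As ! j = {}" if "i \<noteq> j" using j(1) \<open>i < ?l\<close> lenAs that by simp
          with j(2) \<open>x \<in> As ! i\<close> show "i \<le> j" by blast
        next
          show "i < ?l \<and> x \<in> As ! i" using that by blast
        qed
        moreover have "x \<in> X" using that sub by blast
        ultimately show ?thesis by (simp add: c_def)
      qed
      have ex: "\<exists>i<?l. x \<in> As ! i" if "x \<in> X" for x
      proof -
        from that As have "x \<in> \<Union>(set As)" by (simp add: set_partitions_def)
        then show ?thesis unfolding lenAs[symmetric] by (auto simp: in_set_conv_nth)
      qed
      have cls: "{x \<in> X. c x = Suc i} = As ! i" if "i < ?l" for i
      proof (intro equalityI subsetI)
        fix x assume "x \<in> {x \<in> X. c x = Suc i}"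
        then have x: "x \<in> X" "c x = Suc i" by auto
        from ex[OF x(1)] obtain j where j: "j < ?l" "x \<in> As ! j" by blast
        with c[OF j] x(2) show "x \<in> As ! i" by simp
      next
        fix x assume "x \<in> As ! i"
        moreover from this that sub have "x \<in> X" by blast
        ultimately show "x \<in> {x \<in> X. c x = Suc i}" using c[OF that] by simp
      qed
      have "f c = As" by (rule nth_equalityI) (auto simp: len nth lenAs cls)
      moreover have "c \<in> type_funs X w \<beta>"
      proof -
        have "sum w {x \<in> X. c x = Suc i} = \<beta> ! i" if "i < ?l" for i
          using wAs that lenAs by (metis cls nth_map)
        moreover have "c \<in> X \<rightarrow>\<^sub>E {1..}" by (simp add: c_def)
        ultimately show ?thesis by (simp add: type_funs_def)
      qed
      moreover have "x = y \<or> R x y \<or> R y x" if xy: "x \<in> X" "y \<in> X" "c x = c y" for x y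
      proof -
        from ex[OF xy(1)] obtain i where i: "i < ?l" "x \<in> As ! i" by blast
        from ex[OF xy(2)] obtain j where j: "j < ?l" "y \<in> As ! j" by blast
        have "i = j" using c[OF i] c[OF j] xy(3) by simp
        moreover have "is_chain R (As ! i)" using As i lenAs by auto
        ultimately show ?thesis using i j by (auto simp: is_chain_def)
      qed
      ultimately show "As \<in> f ` ?C" by blast
    qed
  qed
  then show ?thesis by (rule bij_betw_same_card)
qed

lemma card_monotone_fillings_eq_type_funs:
  assumes "finite X" "\<And>x. x \<in> X \<Longrightarrow> w x > 0" "sum_list \<beta> = sum w X" "transp R" "irreflp R"
  shows "card (monotone_fillings R X w \<beta>) =
           card {c \<in> type_funs X w \<beta>. \<forall>x\<in>X. \<forall>y\<in>X. c x = c y \<longrightarrow> x = y \<or> R x y \<or> R y x}"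
  by (simp only: card_type_funs_eq_set_partitions[OF assms(1-3)]
      card_monotone_fillings_eq_set_partitions[OF assms(1,4,5)])

text \<open>Proved by permuting rows. It bridges the gap between the refinements of
  \<open>lam\<close>, which are compositions, and the coefficients in
  \<open>trace_evaluation\<close>, which are indexed by partitions.\<close>

lemma card_monotone_fillings_mset_cong:
  assumes "finite X" "mset \<beta> = mset \<beta>'"
  shows "card (monotone_fillings R X w \<beta>) = card (monotone_fillings R X w \<beta>')"
proof -
  \<comment> \<open>Injectivity gives one inequality; exchanging the two lists gives the
    other.\<close>
  have le: "card (monotone_fillings R X w \<beta>) \<le> card (monotone_fillings R X w \<beta>')"
    if mset: "mset \<beta> = mset \<beta>'" for \<beta> \<beta>'
  proof -
    from mset obtain p where p: "p permutes {..<length \<beta>}" "permute_list p \<beta> = \<beta>'"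
      by (metis mset_eq_permutation)
    show ?thesis
    proof (rule card_inj_on_le[where f = "permute_list p"])
      show "permute_list p ` monotone_fillings R X w \<beta> \<subseteq> monotone_fillings R X w \<beta>'"
      proof clarify
        fix U assume U: "U \<in> monotone_fillings R X w \<beta>"
        then have len: "length U = length \<beta>" by (auto simp: monotone_fillings_def fillings_def)
        with p have pU: "p permutes {..<length U}" by simp
        have mU: "mset (permute_list p U) = mset U" using pU by (rule mset_permute_list)
        then have "mset (concat (permute_list p U)) = mset (concat U)"
          by (simp add: mset_concat mset_map[symmetric] sum_mset_sum_list del: mset_map)
            (metis mset_map sum_mset_sum_list)
        then have "distinct (concat (permute_list p U)) = distinct (concat U)"
          "set (concat (permute_list p U)) = set (concat U)"
          by (metis mset_eq_imp_distinct_iff, metis mset_eq_setD)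
        moreover have "map (wt w) (permute_list p U) = \<beta>'"
          using U pU p(2) by (simp add: permute_list_map[symmetric] monotone_fillings_def fillings_def)
        moreover have "set (permute_list p U) = set U" using mU by (rule mset_eq_setD)
        ultimately show "permute_list p U \<in> monotone_fillings R X w \<beta>'"
          using U by (simp add: monotone_fillings_def fillings_def del: set_concat)
      qed
      show "inj_on (permute_list p) (monotone_fillings R X w \<beta>)"
      proof (rule inj_onI)
        fix U V assume UV: "U \<in> monotone_fillings R X w \<beta>" "V \<in> monotone_fillings R X w \<beta>"
          and eq: "permute_list p U = permute_list p V"
        from UV have "map (wt w) U = \<beta>" "map (wt w) V = \<beta>"
          by (simp_all add: monotone_fillings_def fillings_def)
        then have len: "length U = length \<beta>" "length V = length \<beta>" by (metis length_map)+
        have "U ! p i = V ! p i" if "i < length \<beta>" for i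
          using eq that len p(1) by (metis permute_list_nth)
        then have "U ! i = V ! i" if "i < length \<beta>" for i
          using that permutes_image[OF p(1)] by (metis imageE lessThan_iff)
        with len show "U = V" by (simp add: nth_equalityI)
      qed
      show "finite (monotone_fillings R X w \<beta>')" using assms(1) by (rule finite_monotone_fillings)
    qed
  qed
  show ?thesis using le[OF assms(2)] le[OF assms(2)[symmetric]] by simp
qed

lemma poset_greater_strict_order:
  assumes "partial_order_on P r"
  shows "transp (poset_greater r)" "irreflp (poset_greater r)"
proof -
  have "trans r" "antisym r"
    using assms by (auto simp: partial_order_on_def preorder_on_def)
  then show "transp (poset_greater r)"
    by (intro transpI) (auto simp: poset_greater_def dest: transD antisymD)
qed (simp add: irreflp_def poset_greater_def)

text \<open>A color class is an independent set of the incomparability graph, hence a chain, and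
  becomes a row by listing it in descending order.\<close>

lemma card_proper_colorings_of_type:
  assumes "finite P" "partial_order_on P r" "sum_list mu = card P"
  shows "card (proper_colorings_of_type (inc_graph P r) mu) =
           card (monotone_fillings (poset_greater r) P (\<lambda>_. 1) mu)"
proof -
  have refl: "refl_on P r"
    using assms(2) by (simp add: partial_order_on_def preorder_on_def)
  have "proper_colorings_of_type (inc_graph P r) mu =
      {c \<in> type_funs P (\<lambda>_. 1) mu. \<forall>x\<in>P. \<forall>y\<in>P. c x = c y \<longrightarrow>
        x = y \<or> poset_greater r x y \<or> poset_greater r y x}"
  proof -
    have E: "{x, y} \<in> edges (inc_graph P r) \<longleftrightarrow> x \<in> P \<and> y \<in> P \<and> (x, y) \<notin> r \<and> (y, x) \<notin> r" for x y
      by (auto simp: inc_graph_def doubleton_eq_iff)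
    have "(\<forall>x y. {x, y} \<in> edges (inc_graph P r) \<longrightarrow> c x \<noteq> c y) \<longleftrightarrow>
        (\<forall>x\<in>P. \<forall>y\<in>P. c x = c y \<longrightarrow> x = y \<or> poset_greater r x y \<or> poset_greater r y x)" for c :: "'a \<Rightarrow> nat"
      unfolding E poset_greater_def using refl unfolding refl_on_def by blast
    then show ?thesis
      unfolding proper_colorings_of_type_def type_funs_def
      by (auto simp: inc_graph_def)
  qed
  then show ?thesis
    using assms poset_greater_strict_order[OF assms(2)]
    by (subst card_monotone_fillings_eq_type_funs) auto
qed

text \<open>An invariant function factors through the orbit map. Its level sets are unions of
  orbits, so their sizes are sums of orbit sizes; this is the origin of the weight.\<close>

lemma card_invariant_funs_orbits:
  assumes ob: "\<And>c :: nat \<Rightarrow> nat. (\<forall>x\<in>{1..sum_list lam}. c (g x) = c x) \<longleftrightarrow>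
      (\<forall>x\<in>{1..sum_list lam}. \<forall>y\<in>{1..sum_list lam}. ob x = ob y \<longrightarrow> c x = c y)"
  shows "card (invariant_funs g lam) =
    card (type_funs (ob ` {1..sum_list lam}) (\<lambda>k. card {x \<in> {1..sum_list lam}. ob x = k}) lam)"
proof -
  define X where "X = {1..sum_list lam}"
  define w where "w k = card {x \<in> X. ob x = k}" for k
  define f where "f d = restrict (d \<circ> ob) X" for d :: "_ \<Rightarrow> nat"
  have finX: "finite X" by (simp add: X_def)
  have w: "card {x \<in> X. d (ob x) = k} = sum w {z \<in> ob ` X. d z = k}" for d :: "_ \<Rightarrow> nat" and k
  proof -
    let ?S = "{x \<in> X. d (ob x) = k}"
    have "(\<Sum>x\<in>?S. 1 :: nat) = (\<Sum>z\<in>ob ` ?S. \<Sum>x\<in>{x \<in> ?S. ob x = z}. 1)"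
      using finX by (intro sum.image_gen) simp
    then have "card ?S = (\<Sum>z\<in>ob ` ?S. card {x \<in> ?S. ob x = z})" by simp
    also have "ob ` ?S = {z \<in> ob ` X. d z = k}" by auto
    also have "(\<Sum>z\<in>{z \<in> ob ` X. d z = k}. card {x \<in> ?S. ob x = z}) = sum w {z \<in> ob ` X. d z = k}"
      by (rule sum.cong) (auto simp: w_def intro!: arg_cong[where f = card])
    finally show ?thesis .
  qed
  have inv: "invariant_funs g lam =
      {c \<in> type_funs X (\<lambda>_. 1) lam. \<forall>x\<in>X. \<forall>y\<in>X. ob x = ob y \<longrightarrow> c x = c y}"
    unfolding invariant_funs_def ob by (simp add: X_def)
  have clsf: "{x \<in> X. f d x = k} = {x \<in> X. d (ob x) = k}" for d k by (auto simp: f_def)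
  have "bij_betw f (type_funs (ob ` X) w lam) (invariant_funs g lam)"
    unfolding inv
  proof (rule bij_betw_imageI)
    show "inj_on f (type_funs (ob ` X) w lam)"
    proof (rule inj_onI)
      fix d e assume de: "d \<in> type_funs (ob ` X) w lam" "e \<in> type_funs (ob ` X) w lam" "f d = f e"
      show "d = e"
      proof
        fix z
        show "d z = e z"
        proof (cases "z \<in> ob ` X")
          case True
          then obtain x where x: "x \<in> X" "z = ob x" by blast
          from de(3) have "f d x = f e x" by simp
          then show ?thesis using x by (simp add: f_def)
        next
          case False
          then show ?thesis using de by (auto simp: type_funs_def PiE_def extensional_def)
        qed
      qed
    qed
    show "f ` type_funs (ob ` X) w lam =
        {c \<in> type_funs X (\<lambda>_. 1) lam. \<forall>x\<in>X. \<forall>y\<in>X. ob x = ob y \<longrightarrow> c x = c y}" (is "_ = ?C")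
    proof (intro equalityI subsetI)
      fix c assume "c \<in> f ` type_funs (ob ` X) w lam"
      then obtain d where d: "d \<in> type_funs (ob ` X) w lam" "c = f d" by blast
      have "sum (\<lambda>_. 1) {x \<in> X. c x = Suc i} = lam ! i" if "i < length lam" for i
        using d that by (simp add: clsf w type_funs_def)
      moreover have "c \<in> X \<rightarrow>\<^sub>E {1..}" using d by (auto simp: f_def type_funs_def PiE_def Pi_def)
      ultimately show "c \<in> ?C" by (auto simp: type_funs_def d(2) f_def)
    next
      fix c assume c: "c \<in> ?C"
      then have cE: "c \<in> X \<rightarrow>\<^sub>E {1..}" and cT: "\<forall>i<length lam. card {x \<in> X. c x = Suc i} = lam ! i"
        by (simp_all add: type_funs_def)
      \<comment> \<open>The value at an orbit is read off at any representative; invariance makes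
        the choice immaterial.\<close>
      define d where "d = (\<lambda>z\<in>ob ` X. c (inv_into X ob z))"
      have dob: "d (ob x) = c x" if x: "x \<in> X" for x
      proof -
        have "inv_into X ob (ob x) \<in> X" "ob (inv_into X ob (ob x)) = ob x"
          using x by (auto intro: inv_into_into f_inv_into_f)
        then have "c (inv_into X ob (ob x)) = c x" using c x by blast
        then show ?thesis using x by (simp add: d_def)
      qed
      have "f d = c"
      proof
        fix x
        show "f d x = c x"
          using cE dob[of x] by (cases "x \<in> X") (auto simp: f_def PiE_def extensional_def)
      qed
      moreover have "d \<in> type_funs (ob ` X) w lam"
      proof -
        have "sum w {z \<in> ob ` X. d z = Suc i} = lam ! i" if "i < length lam" for i
        proof -
          have "sum w {z \<in> ob ` X. d z = Suc i} = card {x \<in> X. d (ob x) = Suc i}" by (simp add: w)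
          also have "{x \<in> X. d (ob x) = Suc i} = {x \<in> X. c x = Suc i}" using dob by auto
          also have "card \<dots> = lam ! i" using cT that by simp
          finally show ?thesis .
        qed
        moreover have "d \<in> ob ` X \<rightarrow>\<^sub>E {1..}"
        proof (rule PiE_I)
          fix z assume "z \<in> ob ` X"
          then obtain x where "x \<in> X" "z = ob x" by blast
          then show "d z \<in> {1..}" using dob[of x] cE by auto
        qed (simp add: d_def)
        ultimately show ?thesis by (simp add: type_funs_def)
      qed
      ultimately show "c \<in> f ` type_funs (ob ` X) w lam" by blast
    qed
  qed
  then show ?thesis
    unfolding X_def[symmetric] w_def[symmetric] by (metis bij_betw_same_card)
qed

section \<open>The expansion in induced sign characters\<close>

definition decreasing :: "nat list \<Rightarrow> nat list" where
  "decreasing \<beta> = rev (sort \<beta>)"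

lemma mset_decreasing [simp]: "mset (decreasing \<beta>) = mset \<beta>"
  by (simp add: decreasing_def)

lemma sum_list_decreasing [simp]: "sum_list (decreasing \<beta>) = sum_list \<beta>"
  by (metis mset_decreasing sum_mset_sum_list)

lemma sum_list_concat_compositions:
  "as \<in> composition_lists lam \<Longrightarrow> sum_list (concat as) = sum_list lam"
proof -
  have "sum_list (concat as) = sum_list (map sum_list as)" by (induction as) auto
  then show "as \<in> composition_lists lam \<Longrightarrow> sum_list (concat as) = sum_list lam"
    by (simp add: composition_lists_def)
qed

lemma decreasing_concat_in_partitions:
  assumes "lam \<in> partitions_of n" "as \<in> composition_lists lam"
  shows "decreasing (concat as) \<in> partitions_of n"
proof -
  have "set (decreasing (concat as)) = set (concat as)"
    by (simp add: decreasing_def)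
  moreover have "sorted_wrt (\<ge>) (decreasing (concat as))"
    by (simp add: decreasing_def sorted_wrt_rev)
  ultimately show ?thesis
    using assms sum_list_concat_compositions[OF assms(2)]
    by (auto simp: partitions_of_def composition_lists_def)
qed

lemma partitions_eq_if_mset_eq:
  assumes "mu \<in> partitions_of n" "nu \<in> partitions_of m" "mset mu = mset nu"
  shows "mu = nu"
proof -
  have "sorted (rev mu)" "sorted (rev nu)"
    using assms(1,2) by (simp_all add: partitions_of_def sorted_wrt_rev)
  then have "sort nu = rev mu" "sort nu = rev nu"
    using assms(3) by (auto intro: properties_for_sort)
  then show ?thesis by simp
qed

lemma finite_partitions_of: "finite (partitions_of n)"
proof (rule finite_subset)
  show "partitions_of n \<subseteq> {mu. set mu \<subseteq> {..n} \<and> length mu \<le> n}"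
    using length_le_sum_list member_le_sum_list by (fastforce simp: partitions_of_def)
  show "finite {mu. set mu \<subseteq> {..n} \<and> length mu \<le> n}"
    by (rule finite_lists_length_le) simp
qed

lemma successively_less_if_distinct:
  "distinct u \<Longrightarrow> successively (\<lambda>x y :: 'a :: linorder. \<not> y < x) u \<longleftrightarrow> successively (<) u"
  by (induction u rule: induct_list012) auto

text \<open>The orbits of \<open>g\<close>, weighted by their sizes and ordered linearly, take the role of the poset in the
  signed count. A linear order has exactly one increasing filling for every weighted set partition,
  and the sign of \<open>g\<close> is determined by the number of its orbits.\<close>

lemma eta_character_expansion:
  assumes lam: "lam \<in> partitions_of n" and g: "g permutes {1..n}"
  shows "eta_character lam g =
    (\<Sum>as\<in>composition_lists lam. (-1) ^ (n + length (concat as)) * eps_character (decreasing (concat as)) g)"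
proof -
  let ?X = "{1..n}"
  obtain ob where "ob ` ?X \<subseteq> ?X" and ob: "sign g = (-1) ^ (card ?X + card (ob ` ?X))"
    "\<And>c :: nat \<Rightarrow> nat. (\<forall>x\<in>?X. c (g x) = c x) \<longleftrightarrow> (\<forall>x\<in>?X. \<forall>y\<in>?X. ob x = ob y \<longrightarrow> c x = c y)"
    by (rule ex_orbit_map[OF finite_atLeastAtMost g]) (rule that)
  define Y where "Y = ob ` ?X"
  define w where "w k = card {x \<in> ?X. ob x = k}" for k
  have finY: "finite Y" by (simp add: Y_def)
  have w: "w z > 0" if "z \<in> Y" for z
    using that by (auto simp: Y_def w_def card_gt_0_iff)
  have sumw: "sum w Y = n"
  proof -
    have "(\<Sum>x\<in>?X. 1 :: nat) = (\<Sum>z\<in>ob ` ?X. \<Sum>x\<in>{x \<in> ?X. ob x = z}. 1)"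
      by (rule sum.image_gen) simp
    then show ?thesis by (simp add: w_def Y_def)
  qed
  \<comment> \<open>For a total \<open>R\<close> the chain condition always holds, so the count is
    the same for every linear order: \<open>>\<close> will serve for the sign characters and
    \<open><\<close> for the trivial one.\<close>
  have inv: "card (invariant_funs g \<beta>) = card (monotone_fillings R Y w \<beta>)"
    if \<beta>: "sum_list \<beta> = n" and R: "transp R" "irreflp R" "\<And>x y. x = y \<or> R x y \<or> R y x"
    for \<beta> and R :: "nat \<Rightarrow> nat \<Rightarrow> bool"
  proof -
    have "card (invariant_funs g \<beta>) = card (type_funs Y w \<beta>)"
      using card_invariant_funs_orbits[of \<beta> g ob] ob(2) unfolding \<beta> Y_def w_def by blast
    also have "type_funs Y w \<beta> =
        {c \<in> type_funs Y w \<beta>. \<forall>x\<in>Y. \<forall>y\<in>Y. c x = c y \<longrightarrow> x = y \<or> R x y \<or> R y x}"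
      using R(3) by blast
    also have "card \<dots> = card (monotone_fillings R Y w \<beta>)"
      by (rule card_monotone_fillings_eq_type_funs[symmetric])
        (use finY w \<beta> sumw R in simp_all)
    finally show ?thesis .
  qed
  have sum_lam: "sum_list lam = n" using lam by (simp add: partitions_of_def)
  have eps: "eps_character (decreasing (concat as)) g =
      (-1) ^ n * (-1) ^ card Y * of_nat (card (monotone_fillings (>) Y w (concat as)))"
    if as: "as \<in> composition_lists lam" for as
  proof -
    have sum: "sum_list (decreasing (concat as)) = n"
      using sum_list_concat_compositions[OF as] sum_lam by simp
    have "card (invariant_funs g (decreasing (concat as))) =
        card (monotone_fillings (>) Y w (decreasing (concat as)))"
      by (rule inv[OF sum]) auto
    also have "\<dots> = card (monotone_fillings (>) Y w (concat as))"
      by (rule card_monotone_fillings_mset_cong[OF finY]) simp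
    finally show ?thesis
      using eps_character_eq[of g "decreasing (concat as)"] g sum ob(1)
      by (simp add: power_add Y_def)
  qed
  have "eta_character lam g = of_nat (card (invariant_funs g lam))"
    using eta_character_eq[of g lam] g sum_lam by simp
  also have "card (invariant_funs g lam) = card (monotone_fillings (<) Y w lam)"
    by (rule inv[OF sum_lam]) auto
  \<comment> \<open>The letters of a row are distinct, so between neighbors \<open><\<close> is the
    negation of \<open>>\<close>, as the signed count requires.\<close>
  also have "monotone_fillings (<) Y w lam = monotone_fillings (\<lambda>x y. \<not> x > y) Y w lam"
    unfolding monotone_fillings_def
    by (intro Collect_cong conj_cong refl ball_cong)
      (simp add: fillings_iff_set_partitions successively_less_if_distinct)
  also have "of_nat (card \<dots>) = (-1) ^ card Y *
      (complex_of_int ((-1) ^ card Y * int (card (monotone_fillings (\<lambda>x y. \<not> x > y) Y w lam))))"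
    by (simp add: mult.assoc[symmetric] power_mult_distrib[symmetric])
  also have "\<dots> = (-1) ^ card Y * (\<Sum>as\<in>composition_lists lam.
        (-1) ^ length (concat as) * of_nat (card (monotone_fillings (>) Y w (concat as))))"
    by (subst signed_count_monotone_fillings[OF finY w, symmetric]) simp_all
  \<comment> \<open>Inserting the square of (-1)^n produces the factor (-1)^(n + card Y), which is
    the sign of \<open>g\<close>. This completes the values of the sign characters and leaves
    another (-1)^n in the coefficients.\<close>
  also have "\<dots> = (\<Sum>as\<in>composition_lists lam. (-1) ^ (n + length (concat as)) *
        ((-1) ^ n * (-1) ^ card Y * of_nat (card (monotone_fillings (>) Y w (concat as)))))"
  proof -
    have sq: "(-1 :: complex) ^ n * (-1) ^ n = 1" by (simp add: power_mult_distrib[symmetric])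
    have "(-1) ^ card Y * ((-1) ^ l * m) = (-1) ^ (n + l) * ((-1) ^ n * (-1) ^ card Y * m)"
      for l and m :: complex
    proof -
      have "(-1) ^ (n + l) * ((-1) ^ n * (-1) ^ card Y * m) =
          ((-1) ^ n * (-1) ^ n) * ((-1) ^ card Y * ((-1) ^ l * m))"
        by (simp only: power_add ac_simps)
      then show ?thesis by (simp only: sq mult_1)
    qed
    then show ?thesis unfolding sum_distrib_left by (intro sum.cong refl)
  qed
  finally show ?thesis using eps by simp
qed

section \<open>Linear independence of the induced sign characters\<close>

lemma mset_eq_image_mset_sizes:
  assumes "\<And>i. i < length \<beta> \<Longrightarrow> f (Suc i) = \<beta> ! i"
  shows "mset \<beta> = image_mset f (mset_set {1..length \<beta>})"
proof -
  have "\<beta> = map (f \<circ> Suc) [0..<length \<beta>]"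
    by (rule nth_equalityI) (simp_all add: assms)
  then have "mset \<beta> = mset (map (f \<circ> Suc) [0..<length \<beta>])" by (rule arg_cong)
  also have "\<dots> = image_mset f (image_mset Suc (mset_set {0..<length \<beta>}))"
    by (simp add: multiset.map_comp)
  also have "image_mset Suc (mset_set {0..<length \<beta>}) = mset_set {1..length \<beta>}"
    by (simp add: image_mset_mset_set image_Suc_atLeastLessThan atLeastLessThanSuc_atLeastAtMost)
  finally show ?thesis .
qed

text \<open>The blocks of \<open>mu\<close> are made the orbits of \<open>g\<close>. An invariant
  function of type \<open>nu\<close> is constant on each block, so it merges blocks: either
  \<open>nu\<close> has fewer parts, or blocks and values correspond bijectively and the part sizes
  agree.\<close>

lemma ex_permutation_of_cycle_type:
  assumes mu: "mu \<in> partitions_of n"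
  obtains g where "g permutes {1..n}" "invariant_funs g mu \<noteq> {}"
    "\<And>nu. \<lbrakk>nu \<in> partitions_of n; invariant_funs g nu \<noteq> {}\<rbrakk> \<Longrightarrow> length nu < length mu \<or> nu = mu"
proof -
  let ?X = "{1..n}" and ?b = "block_index mu"
  have sum_mu: "sum_list mu = n" using mu by (simp add: partitions_of_def)
  obtain g where g: "g permutes ?X" "\<And>x. x \<in> ?X \<Longrightarrow> ?b (g x) = ?b x"
    "\<And>c x y. \<lbrakk>\<forall>x\<in>?X. c (g x) = c x; x \<in> ?X; y \<in> ?X; ?b x = ?b y\<rbrakk> \<Longrightarrow> (c x :: nat) = c y"
    by (rule ex_permutes_with_orbits[of ?X ?b]) auto
  have gX: "g x \<in> ?X" if "x \<in> ?X" for x using permutes_in_image[OF g(1)] that by simp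
  have "restrict ?b ?X \<in> invariant_funs g mu"
    using block_index_in_type_funs[of mu] g(2) gX
    unfolding invariant_funs_def sum_mu by (simp only: mem_Collect_eq restrict_apply if_True) simp
  moreover have "length nu < length mu \<or> nu = mu"
    if nu: "nu \<in> partitions_of n" and c: "c \<in> invariant_funs g nu" for nu c
  proof -
    have sum_nu: "sum_list nu = n" using nu by (simp add: partitions_of_def)
    have cT: "c \<in> type_funs ?X (\<lambda>_. 1) nu" and cg: "\<forall>x\<in>?X. c (g x) = c x"
      using c unfolding invariant_funs_def sum_nu by blast+
    have cls_c: "card {x \<in> ?X. c x = Suc i} = nu ! i" if "i < length nu" for i
      using cT that by (simp add: type_funs_def)
    have cls_b: "card {x \<in> ?X. ?b x = Suc i} = mu ! i" if "i < length mu" for i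
      using card_block[OF that] unfolding sum_mu .
    have bX: "?b ` ?X = {1..length mu}"
    proof (intro equalityI subsetI)
      fix k assume "k \<in> {1..length mu}"
      then obtain i where i: "k = Suc i" "i < length mu" by (cases k) auto
      with mu have "mu ! i \<noteq> 0" by (metis (mono_tags, lifting) mem_Collect_eq nth_mem partitions_of_def)
      with cls_b[OF i(2)] have "{x \<in> ?X. ?b x = Suc i} \<noteq> {}" by (metis card.empty)
      then obtain x where "x \<in> ?X" "k = ?b x" using i(1) by auto
      then show "k \<in> ?b ` ?X" by blast
    qed (use block_index_range[of _ mu] sum_mu in blast)
    have cX: "c ` ?X = {1..length nu}"
    proof (intro equalityI subsetI)
      fix k assume "k \<in> {1..length nu}"
      then obtain i where i: "k = Suc i" "i < length nu" by (cases k) auto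
      with nu have "nu ! i \<noteq> 0" by (metis (mono_tags, lifting) mem_Collect_eq nth_mem partitions_of_def)
      with cls_c[OF i(2)] have "{x \<in> ?X. c x = Suc i} \<noteq> {}" by (metis card.empty)
      then obtain x where "x \<in> ?X" "k = c x" using i(1) by auto
      then show "k \<in> c ` ?X" by blast
    next
      fix k assume "k \<in> c ` ?X"
      then show "k \<in> {1..length nu}"
        using type_funs_range[OF _ _ _ cT] sum_nu by auto
    qed
    \<comment> \<open>The map that \<open>c\<close> induces from the blocks of \<open>mu\<close> to
      its values. It is onto \<open>{1..length nu}\<close> because the parts of \<open>nu\<close>
      are positive.\<close>
    define F where "F k = c (inv_into ?X ?b k)" for k
    have F: "F (?b x) = c x" if x: "x \<in> ?X" for x
    proof -
      have "inv_into ?X ?b (?b x) \<in> ?X" "?b (inv_into ?X ?b (?b x)) = ?b x"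
        using x by (blast intro: inv_into_into f_inv_into_f)+
      then show ?thesis unfolding F_def using g(3)[OF cg _ x] by blast
    qed
    have "F ` {1..length mu} = c ` ?X"
      unfolding bX[symmetric] image_image by (rule image_cong[OF refl F])
    then have FL: "F ` {1..length mu} = {1..length nu}" using cX by simp
    then have le: "length nu \<le> length mu"
      by (metis card_atLeastAtMost card_image_le diff_Suc_1 finite_atLeastAtMost)
    show ?thesis
    proof (cases "length nu = length mu")
      case False
      with le show ?thesis by simp
    next
      case True
      with FL have injF: "inj_on F {1..length mu}" by (intro eq_card_imp_inj_on) simp_all
      have "mset nu = image_mset (\<lambda>k. card {x \<in> ?X. c x = k}) (mset_set {1..length nu})"
        by (rule mset_eq_image_mset_sizes) (rule cls_c)
      also have "mset_set {1..length nu} = image_mset F (mset_set {1..length mu})"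
        unfolding FL[symmetric] by (rule image_mset_mset_set[OF injF, symmetric])
      also have "image_mset (\<lambda>k. card {x \<in> ?X. c x = k}) (image_mset F (mset_set {1..length mu})) =
          image_mset (\<lambda>k. card {x \<in> ?X. ?b x = k}) (mset_set {1..length mu})"
        unfolding multiset.map_comp
      proof (rule image_mset_cong)
        fix k assume "k \<in># mset_set {1..length mu}"
        then have k: "k \<in> {1..length mu}" by simp
        have "c x = F k \<longleftrightarrow> ?b x = k" if x: "x \<in> ?X" for x
        proof -
          have "?b x \<in> {1..length mu}" using x bX by blast
          then show ?thesis using inj_on_eq_iff[OF injF _ k] F[OF x] by metis
        qed
        then show "((\<lambda>k. card {x \<in> ?X. c x = k}) \<circ> F) k = card {x \<in> ?X. ?b x = k}"
          unfolding comp_def by (intro arg_cong[where f = card]) blast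
      qed
      also have "\<dots> = mset mu"
        by (rule mset_eq_image_mset_sizes[symmetric]) (rule cls_b)
      finally have "mset nu = mset mu" .
      then show ?thesis using partitions_eq_if_mset_eq[OF nu mu] by simp
    qed
  qed
  ultimately show ?thesis using that[OF g(1)] by blast
qed

text \<open>Triangularity by the number of parts. Choose \<open>mu\<close> with the fewest parts
  among the nonzero coefficients and evaluate at a permutation of cycle type \<open>mu\<close>: the
  other characters that do not vanish there have fewer parts, so their coefficients are
  zero.\<close>

lemma eps_characters_independent:
  assumes d0: "\<And>mu. mu \<notin> partitions_of n \<Longrightarrow> d mu = 0"
    and d: "\<And>g. g permutes {1..n} \<Longrightarrow> (\<Sum>mu\<in>partitions_of n. d mu * eps_character mu g) = 0"
  shows "d mu = 0"
proof (rule ccontr)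
  assume "d mu \<noteq> 0"
  then obtain mu where mu: "d mu \<noteq> 0" "\<And>nu. d nu \<noteq> 0 \<Longrightarrow> length mu \<le> length nu"
    using ex_has_least_nat[of "\<lambda>mu. d mu \<noteq> 0" mu length] by blast
  then have mu_part: "mu \<in> partitions_of n" using d0 by blast
  obtain g where g: "g permutes {1..n}" "invariant_funs g mu \<noteq> {}"
    "\<And>nu. \<lbrakk>nu \<in> partitions_of n; invariant_funs g nu \<noteq> {}\<rbrakk> \<Longrightarrow> length nu < length mu \<or> nu = mu"
    using ex_permutation_of_cycle_type[OF mu_part] by blast
  have eps: "eps_character nu g = of_int (sign g) * of_nat (card (invariant_funs g nu))"
    if "nu \<in> partitions_of n" for nu
    using that g(1) by (intro eps_character_eq) (simp add: partitions_of_def)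
  have "d nu * eps_character nu g = 0" if nu: "nu \<in> partitions_of n - {mu}" for nu
  proof (cases "d nu = 0")
    case False
    then have "\<not> length nu < length mu" using mu(2)[of nu] by simp
    with g(3)[of nu] nu have "invariant_funs g nu = {}" by blast
    with eps[of nu] nu show ?thesis by simp
  qed simp
  then have "(\<Sum>nu\<in>partitions_of n - {mu}. d nu * eps_character nu g) = 0"
    by (intro sum.neutral ballI)
  then have "(\<Sum>nu\<in>partitions_of n. d nu * eps_character nu g) = d mu * eps_character mu g"
    by (simp only: sum.remove[OF finite_partitions_of mu_part] add_0_right)
  with d[OF g(1)] mu(1) have "eps_character mu g = 0" by simp
  then have "card (invariant_funs g mu) = 0" using eps[OF mu_part] by simp
  \<comment> \<open>Infinite sets have cardinality 0 as well, so emptiness does not follow from the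
    cardinality alone.\<close>
  moreover have "finite (invariant_funs g mu)"
  proof (rule finite_subset)
    show "invariant_funs g mu \<subseteq> {1..n} \<rightarrow>\<^sub>E {1..length mu}"
    proof
      fix c assume "c \<in> invariant_funs g mu"
      then have c: "c \<in> type_funs {1..n} (\<lambda>_. 1) mu"
        using mu_part by (simp add: invariant_funs_def partitions_of_def)
      then have "c x \<in> {1..length mu}" if "x \<in> {1..n}" for x
        using mu_part that by (intro type_funs_range[OF _ _ _ c]) (auto simp: partitions_of_def)
      with c show "c \<in> {1..n} \<rightarrow>\<^sub>E {1..length mu}"
        unfolding type_funs_def by (auto simp: PiE_iff)
    qed
    show "finite ({1..n} \<rightarrow>\<^sub>E {1..length mu})" by (simp add: finite_PiE)
  qed
  ultimately show False using g(2) by simp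
qed

text \<open>\<open>eps_coeffs\<close> is a definite description, so uniqueness must be supplied: two
  candidates differ by a vanishing combination of sign characters.\<close>

lemma eps_coeffs_eqI:
  assumes "\<And>mu. mu \<notin> partitions_of n \<Longrightarrow> a mu = 0"
    and "\<And>g. g permutes {1..n} \<Longrightarrow> \<theta> g = (\<Sum>mu\<in>partitions_of n. a mu * eps_character mu g)"
  shows "eps_coeffs n \<theta> = a"
  unfolding eps_coeffs_def
proof (rule the_equality)
  show "(\<forall>mu. mu \<notin> partitions_of n \<longrightarrow> a mu = 0) \<and>
      (\<forall>g\<in>carrier (sym_group n). \<theta> g = (\<Sum>mu\<in>partitions_of n. a mu * eps_character mu g))"
    using assms by (simp add: sym_group_carrier)
  fix b assume b: "(\<forall>mu. mu \<notin> partitions_of n \<longrightarrow> b mu = 0) \<and>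
      (\<forall>g\<in>carrier (sym_group n). \<theta> g = (\<Sum>mu\<in>partitions_of n. b mu * eps_character mu g))"
  have "b mu - a mu = 0" for mu
  proof (rule eps_characters_independent[of n "\<lambda>mu. b mu - a mu"])
    fix g assume g: "g permutes {1..n}"
    then have "\<theta> g = (\<Sum>mu\<in>partitions_of n. b mu * eps_character mu g)"
      using b by (simp add: sym_group_carrier)
    with assms(2)[OF g] show "(\<Sum>mu\<in>partitions_of n. (b mu - a mu) * eps_character mu g) = 0"
      by (simp add: left_diff_distrib sum_subtractf)
  qed (use b assms in simp)
  then show "b = a" by (intro ext) simp
qed

text \<open>The signed count acts a second time. Over the orbits of a permutation it gave the
  coefficients of eta^lam; here it runs over the poset, with numbers of colorings in place of
  character values.\<close>

lemma trace_evaluation_eta_character: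
  assumes lam: "lam \<in> partitions_of (card P)" and P: "finite P" "partial_order_on P r"
  shows "trace_evaluation (eta_character lam) (inc_graph P r) =
    of_nat (card (monotone_fillings (\<lambda>x y. \<not> poset_greater r x y) P (\<lambda>_. 1) lam))"
proof -
  define n where "n = card P"
  have lam_n: "lam \<in> partitions_of n" using lam by (simp add: n_def)
  define s where "s as = (-1 :: complex) ^ (n + length (concat as))" for as :: "nat list list"
  let ?CL = "composition_lists lam" and ?d = "\<lambda>as. decreasing (concat as)"
  \<comment> \<open>Several refinements may sort to the same partition; their signs add up to its
    coefficient.\<close>
  define a where "a mu = (\<Sum>as\<in>{as \<in> ?CL. ?d as = mu}. s as)" for mu
  \<comment> \<open>Stated for any \<open>f\<close>, as it is applied both to character values and
    to numbers of colorings.\<close>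
  have regroup: "(\<Sum>mu\<in>partitions_of n. a mu * f mu) = (\<Sum>as\<in>?CL. s as * f (?d as))"
    for f :: "nat list \<Rightarrow> complex"
  proof -
    have "(\<Sum>mu\<in>partitions_of n. a mu * f mu) =
        (\<Sum>mu\<in>partitions_of n. \<Sum>as\<in>{as \<in> ?CL. ?d as = mu}. s as * f (?d as))"
      by (intro sum.cong refl) (simp add: a_def sum_distrib_right)
    also have "\<dots> = (\<Sum>as\<in>?CL. s as * f (?d as))"
      by (rule sum.group)
        (use decreasing_concat_in_partitions[OF lam_n] in
          \<open>auto simp: finite_composition_lists finite_partitions_of\<close>)
    finally show ?thesis .
  qed
  have coeffs: "eps_coeffs n (eta_character lam) = a"
  proof (rule eps_coeffs_eqI)
    fix mu assume "mu \<notin> partitions_of n"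
    then have "{as \<in> ?CL. ?d as = mu} = {}"
      using decreasing_concat_in_partitions[OF lam_n] by blast
    then show "a mu = 0" unfolding a_def by (simp only: sum.empty)
  next
    fix g assume "g permutes {1..n}"
    from eta_character_expansion[OF lam_n this]
    show "eta_character lam g = (\<Sum>mu\<in>partitions_of n. a mu * eps_character mu g)"
      unfolding regroup s_def .
  qed
  have "trace_evaluation (eta_character lam) (inc_graph P r) =
      (\<Sum>mu\<in>partitions_of n. a mu * of_nat (card (proper_colorings_of_type (inc_graph P r) mu)))"
    by (simp add: trace_evaluation_def inc_graph_def Let_def n_def[symmetric] coeffs)
  also have "\<dots> = (\<Sum>as\<in>?CL. s as * of_nat (card (proper_colorings_of_type (inc_graph P r) (?d as))))"
    by (rule regroup)
  also have "\<dots> = (\<Sum>as\<in>?CL. s as *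
      of_nat (card (monotone_fillings (poset_greater r) P (\<lambda>_. 1) (concat as))))"
  proof (intro sum.cong refl arg_cong2[where f = "(*)"] arg_cong[where f = of_nat])
    fix as assume as: "as \<in> ?CL"
    have "sum_list (?d as) = card P"
      using sum_list_concat_compositions[OF as] lam by (simp add: partitions_of_def)
    from card_proper_colorings_of_type[OF P this]
    have "card (proper_colorings_of_type (inc_graph P r) (?d as)) =
        card (monotone_fillings (poset_greater r) P (\<lambda>_. 1) (?d as))" .
    also have "\<dots> = card (monotone_fillings (poset_greater r) P (\<lambda>_. 1) (concat as))"
      by (rule card_monotone_fillings_mset_cong[OF P(1)]) simp
    finally show "card (proper_colorings_of_type (inc_graph P r) (?d as)) =
        card (monotone_fillings (poset_greater r) P (\<lambda>_. 1) (concat as))" .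
  qed
  also have "\<dots> = (-1) ^ n * complex_of_int (\<Sum>as\<in>?CL. (-1) ^ length (concat as) *
      int (card (monotone_fillings (poset_greater r) P (\<lambda>_. 1) (concat as))))"
    by (simp add: s_def power_add sum_distrib_left mult.assoc)
  also have "\<dots> = (-1) ^ n * ((-1) ^ n *
      of_nat (card (monotone_fillings (\<lambda>x y. \<not> poset_greater r x y) P (\<lambda>_. 1) lam)))"
    by (subst signed_count_monotone_fillings[OF P(1)]) (simp_all add: n_def)
  finally show ?thesis by (simp add: mult.assoc[symmetric] power_mult_distrib[symmetric])
qed

lemma tableaux_eq_fillings: "tableaux P lam = fillings P (\<lambda>_. 1) lam"
proof -
  have "wt (\<lambda>_. 1) = (length :: 'a list \<Rightarrow> nat)" by (rule ext) (simp add: wt_def sum_list_triv)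
  then show ?thesis unfolding fillings_def tableaux_def by (simp only:)
qed

lemma monotone_fillings_eq_descent_free:
  "monotone_fillings (\<lambda>x y. \<not> poset_greater r x y) P (\<lambda>_. 1) lam =
     {U \<in> tableaux P lam. descent_free r U}"
proof -
  have "(\<forall>u\<in>set U. successively (\<lambda>x y. \<not> poset_greater r x y) u) \<longleftrightarrow> descent_free r U"
    for U :: "'a list list"
    unfolding descent_free_def successively_conv_nth by (auto simp: all_set_conv_all_nth)
  then show ?thesis unfolding monotone_fillings_def by (simp add: tableaux_eq_fillings)
qed

section \<open>Excedances and acyclic orientations\<close>

text \<open>The pairs are kept, not only their number, because an insertion destroys precisely the
  pair that ends in a given letter.\<close>

fun descents :: "('a \<Rightarrow> 'a \<Rightarrow> bool) \<Rightarrow> 'a list \<Rightarrow> ('a \<times> 'a) set" where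
  "descents gt (x # y # u) = (if gt x y then {(x, y)} else {}) \<union> descents gt (y # u)"
| "descents gt u = {}"

lemma descents_empty_iff: "descents gt u = {} \<longleftrightarrow> successively (\<lambda>x y. \<not> gt x y) u"
  by (induction gt u rule: descents.induct) auto

lemma descents_snd: "(a, z) \<in> descents gt (x # u) \<Longrightarrow> z \<in> set u"
proof (induction u arbitrary: x)
  case (Cons y u)
  then show ?case by (auto split: if_splits)
qed simp

text \<open>The image comes first, so that a pair has the same form as a descent: greater letter,
  then smaller letter.\<close>

definition excedances :: "('a \<Rightarrow> 'a \<Rightarrow> bool) \<Rightarrow> 'a set \<Rightarrow> ('a \<Rightarrow> 'a) \<Rightarrow> ('a \<times> 'a) set" where
  "excedances gt I p = {(x, y). y \<in> I \<and> x = p y \<and> gt x y}"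

text \<open>If \<open>y\<close> does not occur, \<open>m\<close> is put at the end. The choice
  \<open>y = m\<close> stands for this case, so the positions for a new letter \<open>m\<close> are
  indexed by \<open>insert m (set u)\<close>.\<close>

definition insert_before :: "'a \<Rightarrow> 'a \<Rightarrow> 'a list \<Rightarrow> 'a list" where
  "insert_before m y u = takeWhile (\<lambda>x. x \<noteq> y) u @ m # dropWhile (\<lambda>x. x \<noteq> y) u"

lemma set_insert_before: "set (insert_before m y u) = insert m (set u)"
proof -
  have "set (takeWhile (\<lambda>x. x \<noteq> y) u) \<union> set (dropWhile (\<lambda>x. x \<noteq> y) u) = set u"
    unfolding set_append[symmetric] by simp
  then show ?thesis by (auto simp: insert_before_def)
qed

lemma distinct_insert_before:
  assumes "distinct u" "m \<notin> set u"
  shows "distinct (insert_before m y u)"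
proof -
  have "distinct (takeWhile (\<lambda>x. x \<noteq> y) u @ dropWhile (\<lambda>x. x \<noteq> y) u)" using assms(1) by simp
  moreover have "m \<notin> set (takeWhile (\<lambda>x. x \<noteq> y) u @ dropWhile (\<lambda>x. x \<noteq> y) u)"
    using assms(2) by simp
  ultimately show ?thesis unfolding insert_before_def distinct_append set_append by simp
qed

text \<open>Cutting the word at \<open>m\<close> recovers \<open>u\<close>, and \<open>y\<close> is
  the letter that follows \<open>m\<close>.\<close>

lemma insert_before_inject:
  assumes eq: "insert_before m y u = insert_before m z v"
    and m: "m \<notin> set u" "m \<notin> set v" and yz: "y \<in> insert m (set u)" "z \<in> insert m (set v)"
  shows "u = v \<and> y = z"
proof -
  have split: "takeWhile (\<lambda>x. x \<noteq> m) (insert_before m y u) = takeWhile (\<lambda>x. x \<noteq> y) u \<and>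
      dropWhile (\<lambda>x. x \<noteq> m) (insert_before m y u) = m # dropWhile (\<lambda>x. x \<noteq> y) u"
    if "m \<notin> set u" for y u
  proof -
    have "x \<noteq> m" if "x \<in> set (takeWhile (\<lambda>x. x \<noteq> y) u)" for x
      using \<open>m \<notin> set u\<close> that set_takeWhileD by metis
    then show ?thesis
      unfolding insert_before_def by (simp add: takeWhile_append2 dropWhile_append2)
  qed
  \<comment> \<open>The appended \<open>m\<close> covers insertion at the end, where no letter
    follows and \<open>y = m\<close>.\<close>
  have hd_drop: "hd (dropWhile (\<lambda>x. x \<noteq> y) u @ [m]) = y" if "y \<in> insert m (set u)" "m \<notin> set u" for y u
  proof (cases "y \<in> set u")
    case True
    then have "dropWhile (\<lambda>x. x \<noteq> y) u \<noteq> []" by (simp add: dropWhile_eq_Nil_conv)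
    then show ?thesis using hd_dropWhile[of "\<lambda>x. x \<noteq> y" u] by simp
  next
    case False
    then have y: "y = m" using that by simp
    have "dropWhile (\<lambda>x. x \<noteq> y) u = []" using False by (auto simp: dropWhile_eq_Nil_conv)
    then show ?thesis by (simp only: append_Nil list.sel y)
  qed
  have "takeWhile (\<lambda>x. x \<noteq> y) u = takeWhile (\<lambda>x. x \<noteq> z) v"
    using split[OF m(1), of y] split[OF m(2), of z] eq by metis
  moreover have drop: "dropWhile (\<lambda>x. x \<noteq> y) u = dropWhile (\<lambda>x. x \<noteq> z) v"
    using split[OF m(1), of y] split[OF m(2), of z] eq by (metis list.inject)
  ultimately have "u = v" by (metis takeWhile_dropWhile_id)
  moreover have "y = z" using hd_drop[OF yz(1) m(1)] hd_drop[OF yz(2) m(2)] drop by metis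
  ultimately show ?thesis by simp
qed

text \<open>Nothing is greater than \<open>m\<close>, so no descent ends in \<open>m\<close>. The
  only pair of neighbors that is separated is the one ending in \<open>y\<close>, and
  \<open>m\<close> takes over its first place.\<close>

lemma descents_insert_before:
  assumes "distinct u" "m \<notin> set u" "\<forall>x\<in>insert m (set u). \<not> gt x m" "y \<in> insert m (set u)"
  shows "descents gt (insert_before m y u) =
           {(x, z) \<in> descents gt u. z \<noteq> y} \<union> (if gt m y then {(m, y)} else {})"
  using assms
proof (induction u)
  case Nil
  then show ?case by (simp add: insert_before_def)
next
  case (Cons x u)
  show ?case
  proof (cases "x = y")
    case True
    have "z \<noteq> y" if "(a, z) \<in> descents gt (x # u)" for a z
      using descents_snd[OF that] Cons.prems(1) True by auto
    then have "{(a, z) \<in> descents gt (x # u). z \<noteq> y} = descents gt (x # u)" by blast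
    then show ?thesis using True by (simp add: insert_before_def)
  next
    case False
    have IH: "descents gt (insert_before m y u) =
        {(x, z) \<in> descents gt u. z \<noteq> y} \<union> (if gt m y then {(m, y)} else {})"
      using Cons.prems False by (intro Cons.IH) auto
    have ins: "insert_before m y (x # u) = x # insert_before m y u"
      using False by (simp add: insert_before_def)
    have xm: "\<not> gt x m" using Cons.prems(3) by simp
    show ?thesis
    proof (cases u)
      case Nil
      then show ?thesis using Cons.prems False xm by (simp add: insert_before_def)
    next
      case (Cons x' u')
      show ?thesis
      proof (cases "x' = y")
        case True
        then have "insert_before m y u = m # u" using Cons by (simp add: insert_before_def)
        then have "descents gt (insert_before m y (x # u)) = descents gt (insert_before m y u)"
          using xm unfolding ins by simp
        moreover have "{(a, z) \<in> descents gt (x # u). z \<noteq> y} = {(a, z) \<in> descents gt u. z \<noteq> y}"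
          using Cons True by auto
        ultimately show ?thesis using IH by simp
      next
        case False
        then have "insert_before m y u = x' # insert_before m y u'"
          using Cons by (simp add: insert_before_def)
        then have "descents gt (insert_before m y (x # u)) =
            (if gt x x' then {(x, x')} else {}) \<union> descents gt (insert_before m y u)"
          unfolding ins by simp
        moreover have "{(a, z) \<in> descents gt (x # u). z \<noteq> y} =
            (if gt x x' then {(x, x')} else {}) \<union> {(a, z) \<in> descents gt u. z \<noteq> y}"
          using Cons False by auto
        ultimately show ?thesis using IH by (simp only: Un_assoc)
      qed
    qed
  qed
qed

text \<open>The same change in terms of cycles: \<open>y\<close> is now sent to \<open>m\<close>,
  and \<open>m\<close> to the former image of \<open>y\<close>, which is not greater than
  \<open>m\<close>.\<close>

lemma excedances_insert:
  assumes q: "q permutes J" and m: "m \<notin> J" "\<forall>x\<in>insert m J. \<not> gt x m" and y: "y \<in> insert m J"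
  shows "excedances gt (insert m J) (q \<circ> transpose m y) =
           {(x, z) \<in> excedances gt J q. z \<noteq> y} \<union> (if gt m y then {(m, y)} else {})"
proof -
  let ?p = "q \<circ> transpose m y"
  have qm: "q m = m" using q m(1) by (simp add: permutes_not_in)
  then have py: "?p y = m" by simp
  have "q y \<in> insert m J" using y qm permutes_in_image[OF q] by blast
  with m(2) have "\<not> gt (q y) m" by blast
  then have pm: "\<not> gt (?p m) m" by simp
  have other: "?p z = q z" if "z \<noteq> m" "z \<noteq> y" for z using that by simp
  have "(x, z) \<in> excedances gt (insert m J) ?p \<longleftrightarrow>
      (x, z) \<in> excedances gt J q \<and> z \<noteq> y \<or> gt m y \<and> (x, z) = (m, y)" for x z
  proof -
    consider "z = y" | "z = m" "z \<noteq> y" | "z \<noteq> m" "z \<noteq> y" by blast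
    then show ?thesis
    proof cases
      case 1
      then show ?thesis using y py by (auto simp: excedances_def)
    next
      case 2
      then show ?thesis using m(1) pm by (auto simp: excedances_def)
    next
      case 3
      then show ?thesis using other[OF 3] by (auto simp: excedances_def)
    qed
  qed
  then show ?thesis by (auto split: if_splits)
qed

lemma bij_betw_if_inj_card:
  assumes "inj_on f A" "f ` A \<subseteq> B" "finite B" "card A = card B"
  shows "bij_betw f A B"
proof (rule bij_betw_imageI[OF assms(1)])
  show "f ` A = B"
    by (rule card_subset_eq[OF assms(3,2)]) (use assms in \<open>simp add: card_image\<close>)
qed

text \<open>Foata's correspondence. Inserting a maximal element \<open>m\<close> directly before \<open>y\<close> in a word, or
  directly before \<open>y\<close> in its cycle (a permutation maps every letter of a cycle to the preceding
  one), changes the descents and the excedances in the same way.\<close>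

lemma ex_descents_excedances_bij:
  assumes "finite I" "transp gt" "irreflp gt"
  shows "\<exists>\<phi>. bij_betw \<phi> (permutations_of_set I) {p. p permutes I} \<and>
             (\<forall>u\<in>permutations_of_set I. descents gt u = excedances gt I (\<phi> u))"
  using assms(1)
proof (induction "card I" arbitrary: I)
  case 0
  then have "I = {}" by simp
  then show ?case
    by (intro exI[of _ "\<lambda>_. id"]) (auto simp: bij_betw_def excedances_def permutes_empty)
next
  case (Suc n)
  have "I \<noteq> {}" using Suc.hyps(2) by auto
  moreover have "asymp_on I gt" by (rule asymp_onI) (use assms(2,3) in \<open>metis transpD irreflpD\<close>)
  moreover have "transp_on I gt" by (rule transp_onI) (use assms(2) in \<open>metis transpD\<close>)
  \<comment> \<open>Since \<open>gt\<close> means greater, its \<open>bex_min_element\<close> yields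
    a maximal element of the order.\<close>
  ultimately obtain m where m: "m \<in> I" "\<forall>x\<in>I. x \<noteq> m \<longrightarrow> \<not> gt x m"
    using Finite_Set.bex_min_element[OF Suc.prems, of gt] by blast
  have max: "\<forall>x\<in>I. \<not> gt x m" using m(2) assms(3) by (metis irreflpD)
  define J where "J = I - {m}"
  have J: "I = insert m J" "m \<notin> J" "finite J" "card J = n"
    using m(1) Suc.prems Suc.hyps(2) by (auto simp: J_def)
  obtain \<phi> where \<phi>: "bij_betw \<phi> (permutations_of_set J) {p. p permutes J}"
    "\<And>u. u \<in> permutations_of_set J \<Longrightarrow> descents gt u = excedances gt J (\<phi> u)"
    using Suc.hyps(1)[OF J(4)[symmetric] J(3)] by blast
  \<comment> \<open>Words and permutations on \<open>I\<close> are both coded by a word on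
    \<open>J\<close> and an insertion point \<open>y\<close>, where \<open>y = m\<close> means the
    end of the word or a fixed point.\<close>
  let ?A = "permutations_of_set J \<times> I"
  define f where "f = (\<lambda>(u, y). insert_before m y u)"
  define g where "g = (\<lambda>(u, y). \<phi> u \<circ> transpose m y)"
  have uJ: "distinct u" "set u = J" if "u \<in> permutations_of_set J" for u
    using permutations_of_setD[OF that] by simp_all
  have \<phi>J: "\<phi> u permutes J" if "u \<in> permutations_of_set J" for u
    using bij_betwE[OF \<phi>(1)] that by blast
  have cardA: "card ?A = fact (Suc n)"
    using J by (simp add: card_cartesian_product card_permutations_of_set)
  have f: "bij_betw f ?A (permutations_of_set I)"
  proof (rule bij_betw_if_inj_card)
    show "inj_on f ?A"
    proof (rule inj_onI)
      fix a b assume a: "a \<in> ?A" and b: "b \<in> ?A" and eq: "f a = f b"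
      obtain u y v z where ab: "a = (u, y)" "b = (v, z)" by (cases a, cases b)
      then have "u \<in> permutations_of_set J" "v \<in> permutations_of_set J" "y \<in> I" "z \<in> I"
        using a b by simp_all
      with insert_before_inject[of m y u z v] uJ[of u] uJ[of v] J(1,2) eq
      show "a = b" by (simp add: ab f_def)
    qed
    show "f ` ?A \<subseteq> permutations_of_set I"
    proof clarify
      fix u y assume "u \<in> permutations_of_set J" "y \<in> I"
      with uJ[of u] J(1,2) show "f (u, y) \<in> permutations_of_set I"
        by (intro permutations_of_setI) (simp_all add: f_def set_insert_before distinct_insert_before)
    qed
    show "card ?A = card (permutations_of_set I)"
      using cardA Suc.hyps(2) Suc.prems by (simp add: card_permutations_of_set)
  qed simp
  have g: "bij_betw g ?A {p. p permutes I}"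
  proof (rule bij_betw_if_inj_card)
    show "inj_on g ?A"
    proof (rule inj_onI)
      fix a b assume a: "a \<in> ?A" and b: "b \<in> ?A" and eq: "g a = g b"
      obtain u y v z where ab: "a = (u, y)" "b = (v, z)" by (cases a, cases b)
      then have uv: "u \<in> permutations_of_set J" "v \<in> permutations_of_set J"
        using a b by simp_all
      have gg: "\<phi> u \<circ> transpose m y = \<phi> v \<circ> transpose m z" using eq by (simp add: ab g_def)
      \<comment> \<open>The insertion point is recovered as the preimage of \<open>m\<close>, which
        \<open>\<phi> u\<close> and \<open>\<phi> v\<close> fix.\<close>
      have "inj (\<phi> u \<circ> transpose m y)"
        using permutes_inj[OF \<phi>J[OF uv(1)]] by (simp add: inj_compose)
      moreover have "(\<phi> u \<circ> transpose m y) y = m"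
        using permutes_not_in[OF \<phi>J[OF uv(1)] J(2)] by simp
      moreover have "(\<phi> u \<circ> transpose m y) z = m"
        unfolding gg using permutes_not_in[OF \<phi>J[OF uv(2)] J(2)] by simp
      ultimately have "y = z" by (metis injD)
      have "\<phi> u = (\<phi> u \<circ> transpose m y) \<circ> transpose m y" by (simp add: comp_assoc)
      also have "\<dots> = (\<phi> v \<circ> transpose m z) \<circ> transpose m z" by (simp only: \<open>y = z\<close> gg[unfolded \<open>y = z\<close>])
      also have "\<dots> = \<phi> v" by (simp add: comp_assoc)
      finally have "u = v" using \<phi>(1) uv by (meson bij_betw_imp_inj_on inj_onD)
      with \<open>y = z\<close> show "a = b" by (simp add: ab)
    qed
    show "g ` ?A \<subseteq> {p. p permutes I}"
    proof clarify
      fix u y assume "u \<in> permutations_of_set J" "y \<in> I"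
      then have "\<phi> u permutes I" "transpose m y permutes I"
        using \<phi>J permutes_subset[of "\<phi> u" J I] J(1) m(1) by (auto intro: permutes_swap_id)
      then show "g (u, y) permutes I" by (simp add: g_def permutes_compose)
    qed
    show "finite {p. p permutes I}" using Suc.prems by (rule finite_permutations)
    show "card ?A = card {p. p permutes I}"
      using cardA card_permutations[OF Suc.hyps(2)[symmetric] Suc.prems] by simp
  qed
  have fg: "descents gt (f a) = excedances gt I (g a)" if a: "a \<in> ?A" for a
  proof -
    obtain u y where uy: "a = (u, y)" by (cases a)
    with a have u: "u \<in> permutations_of_set J" and y: "y \<in> insert m J" using J(1) by simp_all
    have "descents gt (f a) =
        {(x, z) \<in> descents gt u. z \<noteq> y} \<union> (if gt m y then {(m, y)} else {})"
      unfolding uy f_def prod.case using uJ[OF u] J(1,2) max y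
      by (intro descents_insert_before) simp_all
    also have "descents gt u = excedances gt J (\<phi> u)" by (rule \<phi>(2)[OF u])
    also have "{(x, z) \<in> \<dots>. z \<noteq> y} \<union> (if gt m y then {(m, y)} else {}) = excedances gt I (g a)"
      unfolding uy g_def prod.case J(1)
      by (rule excedances_insert[symmetric]) (use \<phi>J[OF u] J(1,2) max y in simp_all)
    finally show ?thesis .
  qed
  show ?case
  proof (intro exI conjI ballI)
    show "bij_betw (g \<circ> inv_into ?A f) (permutations_of_set I) {p. p permutes I}"
      using bij_betw_inv_into[OF f] g by (rule bij_betw_trans)
    fix u assume u: "u \<in> permutations_of_set I"
    have "inv_into ?A f u \<in> ?A" "f (inv_into ?A f u) = u"
      using f u by (auto simp: bij_betw_def inv_into_into f_inv_into_f)
    with fg[of "inv_into ?A f u"] show "descents gt u = excedances gt I ((g \<circ> inv_into ?A f) u)"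
      by simp
  qed
qed

section \<open>Excedances in the rows of a tableau\<close>

lemma bij_betw_map_permutations_of_set:
  assumes s: "s \<in> permutations_of_set I"
  shows "bij_betw (\<lambda>p. map p s) {p. p permutes I} (permutations_of_set I)"
proof (rule bij_betw_if_inj_card)
  have set_s: "set s = I" "distinct s" using permutations_of_setD[OF s] by simp_all
  then have fin: "finite I" by auto
  show "inj_on (\<lambda>p. map p s) {p. p permutes I}"
  proof (rule inj_onI)
    fix p q assume pq: "p \<in> {p. p permutes I}" "q \<in> {p. p permutes I}" "map p s = map q s"
    show "p = q"
    proof
      fix x
      show "p x = q x"
      proof (cases "x \<in> I")
        case True
        with pq(3) set_s show ?thesis by (simp add: map_eq_conv)
      next
        case False
        with pq show ?thesis by (simp add: permutes_not_in)
      qed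
    qed
  qed
  show "(\<lambda>p. map p s) ` {p. p permutes I} \<subseteq> permutations_of_set I"
  proof clarify
    fix p assume p: "p permutes I"
    show "map p s \<in> permutations_of_set I"
      using permutes_image[OF p] permutes_inj_on[OF p] set_s
      by (intro permutations_of_setI) (simp_all add: distinct_map)
  qed
  show "card {p. p permutes I} = card (permutations_of_set I)"
    using fin by (simp add: card_permutations card_permutations_of_set)
qed simp

definition row_excedance_free :: "('a \<Rightarrow> 'a \<Rightarrow> bool) \<Rightarrow> ('a \<Rightarrow> nat) \<Rightarrow> 'a list \<Rightarrow> bool" where
  "row_excedance_free gt lab u \<longleftrightarrow> (\<forall>j<length u. \<not> gt (u ! j) (sort_key lab u ! j))"

lemma excedance_free_iff_rows:
  "excedance_free r lab U \<longleftrightarrow> (\<forall>u\<in>set U. row_excedance_free (poset_greater r) lab u)"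
  unfolding excedance_free_def row_excedance_free_def sort_rows_def
  by (auto simp: all_set_conv_all_nth)

text \<open>All rows with underlying set \<open>I\<close> have the same sorted row \<open>s\<close>.
  A row is \<open>map p s\<close> for a unique permutation \<open>p\<close>, and comparing it with
  \<open>s\<close> entry by entry compares \<open>p y\<close> with \<open>y\<close>.\<close>

lemma ex_bij_descent_free_excedance_free:
  assumes "finite I" "transp gt" "irreflp gt" "inj_on lab I"
  shows "\<exists>f. bij_betw f
    {u \<in> {u. distinct u \<and> successively (\<lambda>x y. \<not> gt x y) u}. set u = I}
    {u \<in> {u. distinct u \<and> row_excedance_free gt lab u}. set u = I}"
proof -
  obtain \<phi> where \<phi>: "bij_betw \<phi> (permutations_of_set I) {p. p permutes I}"
    "\<And>u. u \<in> permutations_of_set I \<Longrightarrow> descents gt u = excedances gt I (\<phi> u)"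
    using ex_descents_excedances_bij[OF assms(1-3)] by blast
  obtain u0 where u0: "set u0 = I" "distinct u0" using finite_distinct_list[OF assms(1)] by blast
  define s where "s = sort_key lab u0"
  have s: "s \<in> permutations_of_set I" using u0 by (intro permutations_of_setI) (simp_all add: s_def)
  have set_s: "set s = I" using permutations_of_setD[OF s] by simp
  have sort: "sort_key lab u = s" if "u \<in> permutations_of_set I" for u
  proof (rule sort_key_inj_key_eq)
    have u: "set u = I" "distinct u" using permutations_of_setD[OF that] by simp_all
    show "mset u = mset s"
      using u u0 unfolding s_def mset_sort by (simp add: set_eq_iff_mset_eq_distinct[symmetric])
    show "inj_on lab (set u)" using assms(4) u by simp
    show "sorted (map lab s)" by (simp add: s_def)
  qed
  have free: "row_excedance_free gt lab (map p s) \<longleftrightarrow> excedances gt I p = {}" if p: "p permutes I" for p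
  proof -
    have "map p s \<in> permutations_of_set I"
      using bij_betwE[OF bij_betw_map_permutations_of_set[OF s]] p by blast
    from sort[OF this] have "row_excedance_free gt lab (map p s) \<longleftrightarrow> (\<forall>y\<in>set s. \<not> gt (p y) y)"
      by (simp add: row_excedance_free_def all_set_conv_all_nth)
    then show ?thesis unfolding set_s excedances_def by blast
  qed
  have "bij_betw ((\<lambda>p. map p s) \<circ> \<phi>) (permutations_of_set I) (permutations_of_set I)"
    by (rule bij_betw_trans[OF \<phi>(1) bij_betw_map_permutations_of_set[OF s]])
  moreover have "row_excedance_free gt lab (((\<lambda>p. map p s) \<circ> \<phi>) u) \<longleftrightarrow> descents gt u = {}"
    if u: "u \<in> permutations_of_set I" for u
    using \<phi>(2)[OF u] free[of "\<phi> u"] bij_betwE[OF \<phi>(1)] u by simp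
  ultimately have "bij_betw ((\<lambda>p. map p s) \<circ> \<phi>)
      {u \<in> permutations_of_set I. descents gt u = {}}
      {u \<in> permutations_of_set I. row_excedance_free gt lab u}"
    by (rule bij_betw_Collect)
  moreover have "{u \<in> permutations_of_set I. descents gt u = {}} =
      {u \<in> {u. distinct u \<and> successively (\<lambda>x y. \<not> gt x y) u}. set u = I}"
    unfolding permutations_of_set_def descents_empty_iff by blast
  moreover have "{u \<in> permutations_of_set I. row_excedance_free gt lab u} =
      {u \<in> {u. distinct u \<and> row_excedance_free gt lab u}. set u = I}"
    unfolding permutations_of_set_def by blast
  ultimately show ?thesis by (intro exI) simp
qed

section \<open>Words and acyclic orientations\<close>

definition incomparable :: "('a \<Rightarrow> 'a \<Rightarrow> bool) \<Rightarrow> 'a \<Rightarrow> 'a \<Rightarrow> bool" where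
  "incomparable gt x y \<longleftrightarrow> x \<noteq> y \<and> \<not> gt x y \<and> \<not> gt y x"

text \<open>The orientation of the incomparability graph along the word, read as a linear
  order.\<close>

fun arcs :: "('a \<Rightarrow> 'a \<Rightarrow> bool) \<Rightarrow> 'a list \<Rightarrow> 'a rel" where
  "arcs gt [] = {}"
| "arcs gt (x # u) = {(x, y) |y. y \<in> set u \<and> incomparable gt x y} \<union> arcs gt u"

definition orients :: "('a \<Rightarrow> 'a \<Rightarrow> bool) \<Rightarrow> 'a set \<Rightarrow> 'a rel \<Rightarrow> bool" where
  "orients gt I R \<longleftrightarrow>
     (\<forall>x y. (x, y) \<in> R \<longrightarrow> x \<in> I \<and> y \<in> I \<and> incomparable gt x y) \<and>
     (\<forall>x\<in>I. \<forall>y\<in>I. incomparable gt x y \<longrightarrow> (x, y) \<in> R \<longleftrightarrow> (y, x) \<notin> R) \<and> acyclic R"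

lemma arcs_subset: "(x, y) \<in> arcs gt u \<Longrightarrow> x \<in> set u \<and> y \<in> set u \<and> incomparable gt x y"
  by (induction u) auto

lemma arcs_into_hd: "distinct (x # u) \<Longrightarrow> (y, x) \<notin> arcs gt (x # u)"
  using arcs_subset[of y x gt u] by auto

lemma arcs_tl: "distinct (x # u) \<Longrightarrow> arcs gt u = {(a, b) \<in> arcs gt (x # u). a \<noteq> x}"
  using arcs_subset[of _ _ gt u] by fastforce

text \<open>The position in the word is a potential that increases along arcs; this excludes
  cycles.\<close>

lemma ex_arcs_increasing:
  "distinct u \<Longrightarrow> \<exists>f :: 'a \<Rightarrow> nat. \<forall>(a, b)\<in>arcs gt u. f a < f b"
proof (induction u)
  case (Cons x u)
  then obtain f :: "'a \<Rightarrow> nat" where f: "\<forall>(a, b)\<in>arcs gt u. f a < f b" by auto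
  let ?f = "\<lambda>z. if z = x then 0 else Suc (f z)"
  have "?f a < ?f b" if "(a, b) \<in> arcs gt (x # u)" for a b
  proof (cases "(a, b) \<in> arcs gt u")
    case True
    with f have "f a < f b" by blast
    moreover have "a \<noteq> x" "b \<noteq> x" using arcs_subset[OF True] Cons.prems by auto
    ultimately show ?thesis by simp
  next
    case False
    with that Cons.prems show ?thesis by auto
  qed
  then show ?case by (intro exI[of _ ?f]) blast
qed simp

lemma orients_arcs:
  assumes "distinct u"
  shows "orients gt (set u) (arcs gt u)"
  unfolding orients_def
proof (intro conjI allI impI ballI)
  show "(x, y) \<in> arcs gt u \<longleftrightarrow> (y, x) \<notin> arcs gt u"
    if "x \<in> set u" "y \<in> set u" "incomparable gt x y" for x y
    using that assms
  proof (induction u)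
    case (Cons z u)
    have sym: "incomparable gt y x" using Cons.prems(3) by (auto simp: incomparable_def)
    have ne: "x \<noteq> y" using Cons.prems(3) by (auto simp: incomparable_def)
    consider "x = z" | "y = z" | "x \<noteq> z" "y \<noteq> z" by blast
    then show ?case
    proof cases
      case 1
      then show ?thesis
        using arcs_into_hd[of z u y gt] Cons.prems ne by auto
    next
      case 2
      then show ?thesis
        using arcs_into_hd[of z u x gt] Cons.prems ne sym by auto
    next
      case 3
      then show ?thesis using Cons by auto
    qed
  qed simp
  obtain f :: "'a \<Rightarrow> nat" where "\<forall>(a, b)\<in>arcs gt u. f a < f b"
    using ex_arcs_increasing[OF assms] by blast
  then have "arcs gt u \<subseteq> inv_image less_than f" by auto
  then show "acyclic (arcs gt u)"
    using wf_inv_image[OF wf_less_than, of f] wf_acyclic wf_subset by blast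
qed (use arcs_subset in metis)+

text \<open>Being greater than \<open>y\<close> propagates to the right. The next letter
  \<open>z\<close> is not below \<open>x\<close>, so \<open>y > z\<close> is impossible by
  transitivity, and \<open>z\<close> is comparable to \<open>y\<close> because no arc enters
  \<open>y\<close>; hence \<open>z > y\<close>. The letter directly before \<open>y\<close> would
  thus form a descent with it.\<close>

lemma descent_before_source:
  assumes "transp gt" "distinct (x # u)" "successively (\<lambda>a b. \<not> gt a b) (x # u)"
    and "y \<in> set u" "gt x y" "\<forall>z. (z, y) \<notin> arcs gt (x # u)"
  shows False
  using assms(2-)
proof (induction u arbitrary: x)
  case (Cons z u)
  have nz: "\<not> gt x z" using Cons.prems(2) by simp
  then have "z \<noteq> y" using Cons.prems(4) by blast
  then have y: "y \<in> set u" using Cons.prems(3) by simp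
  have no: "\<forall>a. (a, y) \<notin> arcs gt (z # u)" using Cons.prems(5) by simp
  then have "\<not> incomparable gt z y" using y by auto
  moreover have "\<not> gt y z" using nz Cons.prems(4) assms(1) by (metis transpD)
  ultimately have "gt z y" using \<open>z \<noteq> y\<close> by (auto simp: incomparable_def)
  show False
  proof (rule Cons.IH[of z])
    show "distinct (z # u)" using Cons.prems(1) by simp
    show "successively (\<lambda>a b. \<not> gt a b) (z # u)" using Cons.prems(2) by simp
  qed (use y no \<open>gt z y\<close> in blast)+
qed simp

text \<open>Both first letters are sources of the same orientation, hence comparable if different.
  Then the greater one would precede the other in its word, against
  \<open>descent_before_source\<close>.\<close>

lemma arcs_unique:
  assumes "transp gt"
    and "distinct u" "successively (\<lambda>a b. \<not> gt a b) u"
    and "distinct v" "successively (\<lambda>a b. \<not> gt a b) v"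
    and "set u = set v" "arcs gt u = arcs gt v"
  shows "u = v"
  using assms(2-)
proof (induction u arbitrary: v)
  case (Cons x u)
  then obtain y v' where v: "v = y # v'" by (cases v) auto
  have x: "\<forall>z. (z, x) \<notin> arcs gt (x # u)" using arcs_into_hd[OF Cons.prems(1)] by blast
  have y: "\<forall>z. (z, y) \<notin> arcs gt (y # v')" using arcs_into_hd[of y v'] Cons.prems(3) v by blast
  have xy: "x = y"
  proof (rule ccontr)
    assume ne: "x \<noteq> y"
    have yu: "y \<in> set u" using Cons.prems(5) v ne by auto
    have xv: "x \<in> set v'" using Cons.prems(5) v ne by auto
    have y': "\<forall>z. (z, y) \<notin> arcs gt (x # u)" unfolding Cons.prems(6) v by (rule y)
    have x': "\<forall>z. (z, x) \<notin> arcs gt (y # v')" unfolding Cons.prems(6)[unfolded v, symmetric] by (rule x)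
    have "\<not> incomparable gt x y" using spec[OF y', of x] yu by simp
    then consider "gt x y" | "gt y x" using ne by (auto simp: incomparable_def)
    then show False
    proof cases
      case 1
      show ?thesis by (rule descent_before_source[OF assms(1) Cons.prems(1,2) yu 1 y'])
    next
      case 2
      show ?thesis
        by (rule descent_before_source[OF assms(1) Cons.prems(3,4)[unfolded v] xv 2 x'])
    qed
  qed
  have "distinct (x # v')" using Cons.prems(3) v xy by simp
  from arcs_tl[OF this, of gt] arcs_tl[OF Cons.prems(1), of gt] Cons.prems(6)
  have "arcs gt u = arcs gt v'" unfolding v xy by (simp only:)
  moreover have "set u = set v'"
  proof -
    have "x \<notin> set u" "x \<notin> set v'" "insert x (set u) = insert x (set v')"
      using Cons.prems(1,3,5) v xy by simp_all
    then show ?thesis by (simp add: insert_ident)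
  qed
  moreover have "successively (\<lambda>a b. \<not> gt a b) u" "successively (\<lambda>a b. \<not> gt a b) v'"
    using Cons.prems(2,4) v by (auto simp: successively_Cons)
  ultimately have "u = v'" using Cons.prems(1,3) v by (intro Cons.IH) simp_all
  with xy v show ?case by simp
qed simp

text \<open>The word of an acyclic orientation starts with the least of its sources, which are pairwise
  comparable.\<close>

lemma ex_word_of_orientation:
  assumes "finite I" "transp gt" "irreflp gt" "orients gt I R"
  shows "\<exists>u. distinct u \<and> set u = I \<and> successively (\<lambda>a b. \<not> gt a b) u \<and> arcs gt u = R"
  using assms(1,4)
proof (induction "card I" arbitrary: I R)
  case 0
  then have "I = {}" by simp
  with 0 have "R = {}" by (auto simp: orients_def)
  with \<open>I = {}\<close> show ?case by (intro exI[of _ "[]"]) simp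
next
  case (Suc n)
  have R: "\<And>x y. (x, y) \<in> R \<Longrightarrow> x \<in> I \<and> y \<in> I \<and> incomparable gt x y"
    "\<And>x y. \<lbrakk>x \<in> I; y \<in> I; incomparable gt x y\<rbrakk> \<Longrightarrow> (x, y) \<in> R \<longleftrightarrow> (y, x) \<notin> R"
    "acyclic R"
    using Suc.prems(2) unfolding orients_def by blast+
  define S where "S = {x \<in> I. \<forall>z. (z, x) \<notin> R}"
  have "R \<subseteq> I \<times> I" by (rule subrelI) (use R(1) in blast)
  then have "finite R" using Suc.prems(1) by (meson finite_SigmaI finite_subset)
  then have "wf R" using R(3) by (rule finite_acyclic_wf)
  moreover obtain i where "i \<in> I" using Suc.hyps(2) by fastforce
  ultimately obtain z where "z \<in> I" "\<And>y. (y, z) \<in> R \<Longrightarrow> y \<notin> I" by (rule wfE_min) blast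
  then have "z \<in> S" unfolding S_def using R(1) by blast
  then have S: "finite S" "S \<noteq> {}" using Suc.prems(1) by (auto simp: S_def)
  moreover have "asymp_on S gt" by (rule asymp_onI) (use assms(2,3) in \<open>metis transpD irreflpD\<close>)
  moreover have "transp_on S gt" by (rule transp_onI) (use assms(2) in \<open>metis transpD\<close>)
  \<comment> \<open>Since \<open>gt\<close> means greater, its \<open>bex_max_element\<close> yields
    a minimal source in the order.\<close>
  ultimately obtain s where s: "s \<in> S" "\<forall>x\<in>S. x \<noteq> s \<longrightarrow> \<not> gt s x"
    using Finite_Set.bex_max_element[of S gt] by blast
  define J where "J = I - {s}"
  define Q where "Q = {(a, b) \<in> R. a \<noteq> s}"
  have sI: "s \<in> I" "\<And>z. (z, s) \<notin> R" using s(1) by (auto simp: S_def)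
  have J: "card J = n" "finite J" using sI(1) Suc.hyps(2) Suc.prems(1) by (auto simp: J_def)
  have "orients gt J Q"
    unfolding orients_def
  proof (intro conjI allI impI ballI)
    fix x y
    show "x \<in> J" "y \<in> J" "incomparable gt x y" if "(x, y) \<in> Q"
      using that R(1)[of x y] sI(2) by (auto simp: Q_def J_def)
    show "(x, y) \<in> Q \<longleftrightarrow> (y, x) \<notin> Q" if "x \<in> J" "y \<in> J" "incomparable gt x y"
      using that R(2)[of x y] by (auto simp: Q_def J_def)
    show "acyclic Q" using R(3) by (rule acyclic_subset) (auto simp: Q_def)
  qed
  then obtain u where u: "distinct u" "set u = J" "successively (\<lambda>a b. \<not> gt a b) u" "arcs gt u = Q"
    using Suc.hyps(1)[OF J(1)[symmetric] J(2)] by blast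
  have "{(s, y) |y. y \<in> J \<and> incomparable gt s y} = {(a, b) \<in> R. a = s}"
  proof (intro equalityI subsetI)
    fix p assume "p \<in> {(s, y) |y. y \<in> J \<and> incomparable gt s y}"
    then obtain y where y: "p = (s, y)" "y \<in> I" "incomparable gt s y" by (auto simp: J_def)
    with R(2)[OF sI(1) y(2,3)] sI(2) show "p \<in> {(a, b) \<in> R. a = s}" by simp
  next
    fix p assume "p \<in> {(a, b) \<in> R. a = s}"
    then obtain b where b: "p = (s, b)" "(s, b) \<in> R" by auto
    with R(1)[OF b(2)] show "p \<in> {(s, y) |y. y \<in> J \<and> incomparable gt s y}"
      by (auto simp: J_def incomparable_def)
  qed
  then have arcs: "arcs gt (s # u) = R" using u by (auto simp: Q_def)
  \<comment> \<open>An arc of \<open>R\<close> into the first letter of \<open>u\<close> could only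
    come from \<open>s\<close>. If \<open>s\<close> were greater than that letter, there would be no
    such arc, and the letter would be a source below \<open>s\<close>.\<close>
  have "\<not> gt s (hd u)" if "u \<noteq> []"
  proof
    assume gt: "gt s (hd u)"
    from that obtain y u' where y: "u = y # u'" by (cases u) auto
    have "(z, y) \<notin> R" for z
    proof
      assume zy: "(z, y) \<in> R"
      have "(z, y) \<notin> Q" unfolding u(4)[symmetric] y by (rule arcs_into_hd) (use u(1) y in simp)
      with zy have "z = s" by (simp add: Q_def)
      with zy R(1) gt y show False by (auto simp: incomparable_def)
    qed
    then have "y \<in> S" using u(2) y by (auto simp: S_def J_def)
    with s(2) gt y u(2) show False by (auto simp: J_def)
  qed
  then have "successively (\<lambda>a b. \<not> gt a b) (s # u)" using u(3) by (auto simp: successively_Cons)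
  moreover have "distinct (s # u)" "set (s # u) = I" using u(1,2) sI(1) by (auto simp: J_def)
  ultimately show ?case using arcs by blast
qed

section \<open>Orientations of incomparability graphs\<close>

lemma edges_inc_graph_iff:
  assumes "refl_on P r" "I \<subseteq> P"
  shows "{x, y} \<in> edges (inc_graph I r) \<longleftrightarrow>
           x \<in> I \<and> y \<in> I \<and> incomparable (poset_greater r) x y"
proof -
  have "{x, y} \<in> edges (inc_graph I r) \<longleftrightarrow> x \<in> I \<and> y \<in> I \<and> (x, y) \<notin> r \<and> (y, x) \<notin> r"
    by (auto simp: inc_graph_def doubleton_eq_iff)
  also have "\<dots> \<longleftrightarrow> x \<in> I \<and> y \<in> I \<and> incomparable (poset_greater r) x y"
    using assms unfolding incomparable_def poset_greater_def refl_on_def by blast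
  finally show ?thesis .
qed

text \<open>Surjectivity of the map from arcs to edges gives every edge at least one direction.
  Injectivity gives at most one, because opposite arcs have the same edge and are distinct, there
  being no loops.\<close>

lemma acyclic_orientation_iff_orients:
  assumes "refl_on P r" "I \<subseteq> P"
  shows "acyclic_orientation (inc_graph I r) (I, R) \<longleftrightarrow> orients (poset_greater r) I R"
proof -
  let ?gt = "poset_greater r" and ?E = "edges (inc_graph I r)"
  note E = edges_inc_graph_iff[OF assms]
  have E': "\<exists>x y. e = {x, y}" if "e \<in> ?E" for e using that by (auto simp: inc_graph_def)
  have inc: "incomparable ?gt y x \<longleftrightarrow> incomparable ?gt x y" "\<not> incomparable ?gt x x" for x y
    by (auto simp: incomparable_def)
  have "bij_betw (\<lambda>(x, y). {x, y}) R ?E \<longleftrightarrow>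
      (\<forall>x y. (x, y) \<in> R \<longrightarrow> x \<in> I \<and> y \<in> I \<and> incomparable ?gt x y) \<and>
      (\<forall>x\<in>I. \<forall>y\<in>I. incomparable ?gt x y \<longrightarrow> (x, y) \<in> R \<longleftrightarrow> (y, x) \<notin> R)"
    (is "?bij \<longleftrightarrow> ?sub \<and> ?one")
  proof (intro iffI conjI)
    assume bij: ?bij
    then have img: "(\<lambda>(x, y). {x, y}) ` R = ?E" and inj: "inj_on (\<lambda>(x, y). {x, y}) R"
      by (auto simp: bij_betw_def)
    have RE: "{x, y} \<in> ?E" if "(x, y) \<in> R" for x y
      using imageI[OF that, of "\<lambda>(x, y). {x, y}"] unfolding img by simp
    then show ?sub using E by blast
    show ?one
    proof (intro ballI impI)
      fix x y assume xy: "x \<in> I" "y \<in> I" "incomparable ?gt x y"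
      then have "{x, y} \<in> (\<lambda>(x, y). {x, y}) ` R" unfolding img using E by blast
      then obtain a b where "(a, b) \<in> R" "{x, y} = {a, b}" by auto
      then have "(x, y) \<in> R \<or> (y, x) \<in> R" by (auto simp: doubleton_eq_iff)
      moreover have "\<not> ((x, y) \<in> R \<and> (y, x) \<in> R)"
      proof
        assume R: "(x, y) \<in> R \<and> (y, x) \<in> R"
        have "(x, y) = (y, x)"
        proof (rule inj_onD[OF inj])
          show "(case (x, y) of (x, y) \<Rightarrow> {x, y}) = (case (y, x) of (x, y) \<Rightarrow> {x, y})"
            by (simp add: insert_commute)
        qed (use R in blast)+
        then have "x = y" by (rule Pair_inject)
        with xy(3) inc(2) show False by simp
      qed
      ultimately show "(x, y) \<in> R \<longleftrightarrow> (y, x) \<notin> R" by blast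
    qed
  next
    assume "?sub \<and> ?one"
    then have sub: ?sub and one: ?one by blast+
    show ?bij
    proof (rule bij_betw_imageI)
      show "inj_on (\<lambda>(x, y). {x, y}) R"
      proof (rule inj_onI)
        fix p q assume p: "p \<in> R" and q: "q \<in> R" and eq: "(\<lambda>(x, y). {x, y}) p = (\<lambda>(x, y). {x, y}) q"
        obtain a b c d where pq: "p = (a, b)" "q = (c, d)" by (cases p, cases q)
        with eq have "a = c \<and> b = d \<or> a = d \<and> b = c" by (simp add: doubleton_eq_iff)
        moreover have "\<not> (a = d \<and> b = c)" using p q pq sub one by blast
        ultimately show "p = q" using pq by simp
      qed
      show "(\<lambda>(x, y). {x, y}) ` R = ?E"
      proof (intro equalityI subsetI)
        fix e assume "e \<in> (\<lambda>(x, y). {x, y}) ` R"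
        then obtain x y where "(x, y) \<in> R" "e = {x, y}" by auto
        then show "e \<in> ?E" using sub E by blast
      next
        fix e assume e: "e \<in> ?E"
        with E' obtain x y where xy: "e = {x, y}" by blast
        with e E have "x \<in> I" "y \<in> I" "incomparable ?gt x y" by blast+
        with one have "(x, y) \<in> R \<or> (y, x) \<in> R" by blast
        then show "e \<in> (\<lambda>(x, y). {x, y}) ` R"
        proof
          assume "(x, y) \<in> R"
          from imageI[OF this, of "\<lambda>(x, y). {x, y}"] show ?thesis using xy by simp
        next
          assume "(y, x) \<in> R"
          from imageI[OF this, of "\<lambda>(x, y). {x, y}"] show ?thesis using xy by (simp add: insert_commute)
        qed
      qed
    qed
  qed
  then show ?thesis
    unfolding acyclic_orientation_def orients_def by (simp add: inc_graph_def)
qed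

lemma ex_bij_descent_free_acyclic_orientations:
  assumes "finite I" "partial_order_on P r" "I \<subseteq> P"
    and trans: "transp (poset_greater r)" "irreflp (poset_greater r)"
  shows "\<exists>f. bij_betw f
    {u \<in> {u. distinct u \<and> successively (\<lambda>x y. \<not> poset_greater r x y) u}. set u = I}
    {D \<in> {D. acyclic_orientation (inc_graph (fst D) r) D}. fst D = I}"
proof -
  let ?gt = "poset_greater r"
  let ?A = "{u \<in> {u. distinct u \<and> successively (\<lambda>x y. \<not> ?gt x y) u}. set u = I}"
  have refl: "refl_on P r" using assms(2) by (simp add: partial_order_on_def preorder_on_def)
  have "{D \<in> {D. acyclic_orientation (inc_graph (fst D) r) D}. fst D = I} =
      Pair I ` {R. orients ?gt I R}"
    using acyclic_orientation_iff_orients[OF refl assms(3)] by (auto simp: image_iff)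
  moreover have "bij_betw (arcs ?gt) ?A {R. orients ?gt I R}"
  proof (rule bij_betw_imageI)
    show "inj_on (arcs ?gt) ?A"
      by (rule inj_onI) (auto intro: arcs_unique[OF trans(1)])
    show "arcs ?gt ` ?A = {R. orients ?gt I R}"
    proof (intro equalityI subsetI)
      fix R assume "R \<in> arcs ?gt ` ?A"
      then show "R \<in> {R. orients ?gt I R}" using orients_arcs by blast
    next
      fix R assume "R \<in> {R. orients ?gt I R}"
      then show "R \<in> arcs ?gt ` ?A"
        using ex_word_of_orientation[OF assms(1) trans, of R] by blast
    qed
  qed
  moreover have "bij_betw (Pair I) {R. orients ?gt I R} (Pair I ` {R. orients ?gt I R})"
    by (rule inj_on_imp_bij_betw) (simp add: inj_on_def)
  ultimately show ?thesis using bij_betw_trans by (metis (no_types, lifting))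
qed

text \<open>An orientation records its vertex set, so a sequence of orientations determines its
  ordered set partition. The union thus becomes a condition on \<open>Os\<close> alone, in the form
  that \<open>card_lists_eq_of_fibres\<close> handles.\<close>

lemma acyclic_orientation_sequences_eq:
  "(\<Union>Gs\<in>induced_sequences lam (inc_graph P r). acyclic_orientation_sequences Gs) =
     {Os \<in> lists {D. acyclic_orientation (inc_graph (fst D) r) D}.
        map fst Os \<in> set_partitions P (\<lambda>_. 1) lam}"
proof -
  have restr: "inc_graph I (Restr r I) = inc_graph I r" for I :: "'a set"
    unfolding inc_graph_def by auto
  have key: "list_all2 acyclic_orientation (map (\<lambda>I. inc_graph I r) Is) Os \<longleftrightarrow>
      Is = map fst Os \<and> Os \<in> lists {D. acyclic_orientation (inc_graph (fst D) r) D}"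
    for Is and Os :: "('a set \<times> 'a rel) list"
  proof (induction Is arbitrary: Os)
    case (Cons I Is)
    have "acyclic_orientation (inc_graph I r) D \<longleftrightarrow>
        I = fst D \<and> acyclic_orientation (inc_graph (fst D) r) D" for D :: "'a set \<times> 'a rel"
      unfolding acyclic_orientation_def by (auto simp: inc_graph_def)
    with Cons show ?case by (cases Os) auto
  qed auto
  show ?thesis
    unfolding induced_sequences_inc_graph restr acyclic_orientation_sequences_def
      ordered_set_partitions_eq UN_simps
    using key by (auto simp: image_iff)
qed

theorem theorem3p7:
  fixes P :: "'a set" and r :: "'a rel" and lab :: "'a \<Rightarrow> nat" and lam :: "nat list"
  assumes "finite P"
    and "partial_order_on P r"
    and "bij_betw lab P {1..card P}"
    and "lam \<in> partitions_of (card P)"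
  shows "trace_evaluation (eta_character lam) (inc_graph P r) =
           of_nat (card {U \<in> tableaux P lam. descent_free r U}) \<and>
         trace_evaluation (eta_character lam) (inc_graph P r) =
           of_nat (card {U \<in> tableaux P lam. excedance_free r lab U}) \<and>
         trace_evaluation (eta_character lam) (inc_graph P r) =
           of_nat (card (\<Union>Gs\<in>induced_sequences lam (inc_graph P r).
                           acyclic_orientation_sequences Gs))"
proof -
  let ?gt = "poset_greater r" and ?trace = "trace_evaluation (eta_character lam) (inc_graph P r)"
  \<comment> \<open>The sets of (1), (2) and (3) all consist of lists whose entries, words or
    orientations, have underlying sets forming a sequence in \<open>S\<close>. So it suffices to
    compare single entries over a fixed set \<open>I\<close>.\<close>
  define W where "W = {u. distinct u \<and> successively (\<lambda>x y. \<not> ?gt x y) u}"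
  define S where "S = set_partitions P (\<lambda>_. 1) lam"
  note order = poset_greater_strict_order[OF assms(2)]
  have S: "S \<subseteq> lists (Pow P)" by (auto simp: S_def set_partitions_def)
  have fin: "finite I" "inj_on lab I" if "I \<in> Pow P" for I
    using that assms(1,3) by (auto intro: finite_subset inj_on_subset simp: bij_betw_def)
  have trace: "?trace = of_nat (card {U \<in> tableaux P lam. descent_free r U})"
    unfolding monotone_fillings_eq_descent_free[symmetric]
    by (rule trace_evaluation_eta_character[OF assms(4,1,2)])
  have words: "{U \<in> tableaux P lam. descent_free r U} = {U \<in> lists W. map set U \<in> S}"
    unfolding monotone_fillings_eq_descent_free[symmetric]
    by (auto simp: monotone_fillings_def fillings_iff_set_partitions W_def S_def)
  have "card {U \<in> lists W. map set U \<in> S} =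
      card {U \<in> lists {u. distinct u \<and> row_excedance_free ?gt lab u}. map set U \<in> S}"
    unfolding W_def
    by (rule card_lists_eq_of_fibres[OF _ S])
      (rule ex_bij_descent_free_excedance_free[OF fin(1) order fin(2)])
  also have "{U \<in> lists {u. distinct u \<and> row_excedance_free ?gt lab u}. map set U \<in> S} =
      {U \<in> tableaux P lam. excedance_free r lab U}"
    unfolding tableaux_eq_fillings excedance_free_iff_rows
    by (auto simp: fillings_iff_set_partitions S_def)
  finally have exc: "card {U \<in> tableaux P lam. descent_free r U} =
      card {U \<in> tableaux P lam. excedance_free r lab U}"
    unfolding words .
  have "card {U \<in> lists W. map set U \<in> S} =
      card {Os \<in> lists {D. acyclic_orientation (inc_graph (fst D) r) D}. map fst Os \<in> S}"
    unfolding W_def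
    by (rule card_lists_eq_of_fibres[OF _ S])
      (rule ex_bij_descent_free_acyclic_orientations[OF fin(1) assms(2) PowD order])
  then have "card {U \<in> tableaux P lam. descent_free r U} =
      card (\<Union>Gs\<in>induced_sequences lam (inc_graph P r). acyclic_orientation_sequences Gs)"
    unfolding words acyclic_orientation_sequences_eq S_def .
  with trace exc show ?thesis by simp
qed

end
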